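(* Let $(\xi,\eta)\in\mathbb{C}^2\setminus\{(0,0)\}$. The spinor $(\xi,\eta)$ maps under $\Phi_2\circ\Phi_1$ to a decorated horosphere whose centre is at $\xi/\eta$ in the upper half space model. Moreover: (1) if $\eta\neq0$, then the horosphere has Euclidean diameter $|\eta|^{-2}$, and decoration north-pole specified by $i/\eta^2$; (2) if $\eta=0$, then the horosphere has height $|\xi|^2$, and decoration specified by $i\xi^2$.
   Context: Minkowski space. $\mathbb{R}^{1,3}$ has coordinates $(T,X,Y,Z)$ and metric $\langle\cdot,\cdot\rangle$ given by $dT^2-dX^2-dY^2-dZ^2$; it is identified with the space of $2\times2$ Hermitian matrices by $(T,X,Y,Z)\leftrightarrow\frac12\begin{pmatrix} T+Z & X+iY \\ X-iY & T-Z \end{pmatrix}$. The future light cone is $L^+=\{x:\langle x,x\rangle=0,\ T>0\}$. Flags. A (pointed oriented null) flag consists of a point $p\in L^+$, the line $\mathbb{R}p$ oriented towards the future, and a 2-plane $V\supset\mathbb{R}p$ tangent to $L^+$ (so $\mathbb{R}p\subset V\subset p^\perp$) with an orientation on $V/\mathbb{R}p$. For linearly independent $p\in L^+$, $v\in T_pL^+$, $[[p,v]]$ denotes the flag with point $p$, plane spanned by $p,v$, and orientation on $V/\mathbb{R}p$ induced by $v$. $\mathcal{F}$ is the set of flags. The map $\Phi_1$. Spinors $\kappa=(\xi,\eta)\in\mathbb{C}^2$ are column vectors, with $\kappa^*$ the conjugate transpose. Let $\phi_1(\kappa)=\kappa\kappa^*$, whose derivative at $\kappa$ in direction $\nu$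 is $D_\kappa\phi_1(\nu)=\kappa\nu^*+\nu\kappa^*$, and let $\mathcal{Z}(\xi,\eta)=(i\overline\eta,-i\overline\xi)$. Then $\Phi_1:\mathbb{C}^2\setminus\{0\}\to\mathcal{F}$ is $\Phi_1(\kappa)=[[\phi_1(\kappa),D_\kappa\phi_1(\mathcal{Z}\kappa)]]$. The map $\Phi_2$. The hyperboloid model is $\mathbb{H}^3=\{x\in\mathbb{R}^{1,3}:\langle x,x\rangle=1,\ T>0\}$. $\Phi_2$ sends a flag with point $p$ and plane $V$ to the horosphere $\phi_2(p)=\{x\in\mathbb{H}^3:\langle x,p\rangle=1\}$ with the oriented line field given at each point $q$ by $T_q\phi_2(p)\cap V$, oriented by the orientation on $V/\mathbb{R}p$. A decorated horosphere is a horosphere with a parallel oriented line field (one invariant under all parabolic isometries fixing the horosphere). Upper half space. $\mathbb{U}^3=\{(x,y,z):z>0\}$ with metric $(dx^2+dy^2+dz^2)/z^2$ and boundary $\mathbb{C}\cup\{\infty\}$, $(x,y)\leftrightarrow x+yi$. One passes from $\mathbb{H}^3$ to the conformal ball model $\mathbb{D}^3$ by $(T,X,Y,Z)\mapsto\frac1{1+T}(X,Y,Z)$, and from $\mathbb{D}^3$ to $\mathbb{U}^3$ by the isometry which on boundaries is $(x,y,z)\mapsto\frac{x+iy}{1-z}$. The centre of a horosphere is its point at infinity. A horosphere centred at $\infty$ is a horizontal plane; its height is its $z$-coordinate, and a decoration on it is specified by $w\in\mathbb{C}\setminus\{0\}$ (up to positive multiples) if it points in the direction $(\mathrm{Re}\,w,\mathrm{Im}\,w,0)$.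 Any other horosphere is a sphere tangent to $\mathbb{C}$; its Euclidean diameter is the maximum of $z$ on it, and a decoration is north-pole specified by $w$ if it points in the direction $(\mathrm{Re}\,w,\mathrm{Im}\,w,0)$ at the point of maximum $z$. *)

theory Defs
  imports "HOL-Analysis.Analysis"
begin

section \<open>Minkowski space\<close>

text \<open>A vector \<open>x :: real^4\<close> has coordinates \<open>(T, X, Y, Z) = (x$1, x$2, x$3, x$4)\<close>.\<close>

definition mink :: "real^4 \<Rightarrow> real^4 \<Rightarrow> real" where
  "mink x y = x$1 * y$1 - x$2 * y$2 - x$3 * y$3 - x$4 * y$4"

definition herm_of_mink :: "real^4 \<Rightarrow> complex^2^2" where
  "herm_of_mink x = vector
     [vector [Complex ((x$1 + x$4) / 2) 0, Complex (x$2 / 2) (x$3 / 2)],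
      vector [Complex (x$2 / 2) (- x$3 / 2), Complex ((x$1 - x$4) / 2) 0]]"

text \<open>The inverse of \<open>herm_of_mink\<close> on Hermitian matrices (see \<open>herm_of_mink_inverse\<close> and
  \<open>mink_of_herm_inverse\<close>).\<close>

definition mink_of_herm :: "complex^2^2 \<Rightarrow> real^4" where
  "mink_of_herm M =
     vector [Re (M$1$1 + M$2$2), 2 * Re (M$1$2), 2 * Im (M$1$2), Re (M$1$1 - M$2$2)]"

definition light_cone :: "(real^4) set" where
  "light_cone = {x. mink x x = 0 \<and> x$1 > 0}"

definition hyperboloid :: "(real^4) set" where
  "hyperboloid = {x. mink x x = 1 \<and> x$1 > 0}"

text \<open>Tangent vectors of a submanifold as velocities of curves contained in it.  For \<open>q \<notin> S\<close> the set
  is empty.\<close>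

definition tangent_space :: "'a::real_normed_vector set \<Rightarrow> 'a \<Rightarrow> 'a set" where
  "tangent_space S q =
     {v. \<exists>c. c 0 = q \<and> (\<forall>t::real. c t \<in> S) \<and> (c has_vector_derivative v) (at 0)}"


section \<open>Flags\<close>

text \<open>An orientation of the one-dimensional quotient \<open>V / \<real>p\<close> is encoded by the set of those vectors of
  \<open>V\<close> whose class is positive, i.e. by one of the two open half-planes into which \<open>\<real>p\<close> cuts \<open>V\<close>.
  The line \<open>\<real>p\<close> and its orientation towards the future are determined by the point \<open>p\<close>.\<close>

datatype flag =
  Flag (flag_point: "real^4") (flag_plane: "(real^4) set") (flag_positive: "(real^4) set")

definition half_plane :: "real^4 \<Rightarrow> real^4 \<Rightarrow> (real^4) set" where
  "half_plane p v = {a *\<^sub>R p + b *\<^sub>R v | a b. b > 0}"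

definition flags :: "flag set" where
  "flags = {Flag p V P | p V P. p \<in> light_cone \<and> subspace V \<and> dim V = 2 \<and> p \<in> V \<and>
     V \<subseteq> tangent_space light_cone p \<and> (\<forall>v\<in>V. mink v p = 0) \<and>
     (\<exists>v\<in>V. v \<notin> span {p} \<and> P = half_plane p v)}"

text \<open>The flag \<open>[[p, v]]\<close>.\<close>

definition flag_of :: "real^4 \<Rightarrow> real^4 \<Rightarrow> flag" where
  "flag_of p v = Flag p (span {p, v}) (half_plane p v)"


section \<open>From spinors to flags\<close>

text \<open>The matrix \<open>\<kappa>\<nu>\<^sup>*\<close>.\<close>

definition outer :: "complex^2 \<Rightarrow> complex^2 \<Rightarrow> complex^2^2" where
  "outer \<kappa> \<nu> = (\<chi> i j. \<kappa>$i * cnj (\<nu>$j))"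

definition phi1 :: "complex^2 \<Rightarrow> real^4" where
  "phi1 \<kappa> = mink_of_herm (outer \<kappa> \<kappa>)"

text \<open>The derivative of \<open>phi1\<close> (see \<open>has_derivative_phi1\<close>).\<close>

definition D_phi1 :: "complex^2 \<Rightarrow> complex^2 \<Rightarrow> real^4" where
  "D_phi1 \<kappa> \<nu> = mink_of_herm (outer \<kappa> \<nu> + outer \<nu> \<kappa>)"

definition Z_map :: "complex^2 \<Rightarrow> complex^2" where
  "Z_map \<kappa> = vector [\<i> * cnj (\<kappa>$2), - \<i> * cnj (\<kappa>$1)]"

definition Phi1 :: "complex^2 \<Rightarrow> flag" where
  "Phi1 \<kappa> = flag_of (phi1 \<kappa>) (D_phi1 \<kappa> (Z_map \<kappa>))"


section \<open>From flags to decorated horospheres\<close>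

text \<open>An oriented line (through the origin of a tangent space) is encoded by its open positive ray.
  A surface with an oriented line field is a pair of a set \<open>S\<close> and a function which assigns
  to each point of \<open>S\<close> such a ray of tangent vectors (and to other points the empty set).\<close>

definition open_ray :: "'a::real_vector \<Rightarrow> 'a set" where
  "open_ray v = {t *\<^sub>R v | t. t > 0}"

type_synonym 'a line_field_surface = "'a set \<times> ('a \<Rightarrow> 'a set)"

definition phi2 :: "real^4 \<Rightarrow> (real^4) set" where
  "phi2 p = {x \<in> hyperboloid. mink x p = 1}"

text \<open>The line \<open>T\<^sub>q \<inter> V\<close> is transverse to \<open>\<real>p\<close>, so its positive ray is its intersection with the positive
  half-plane of \<open>V\<close>.\<close>

definition Phi2 :: "flag \<Rightarrow> (real^4) line_field_surface" where
  "Phi2 F = (phi2 (flag_point F),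
     \<lambda>q. tangent_space (phi2 (flag_point F)) q \<inter> flag_plane F \<inter> flag_positive F)"

text \<open>Orientation-preserving isometries of the hyperboloid model, as proper orthochronous Lorentz
  transformations.\<close>

definition oriented_isometry :: "real^4^4 \<Rightarrow> bool" where
  "oriented_isometry A \<longleftrightarrow> (\<forall>x y. mink (A *v x) (A *v y) = mink x y) \<and>
     (\<lambda>x. A *v x) ` hyperboloid = hyperboloid \<and> det A = 1"

text \<open>Parabolic: no fixed point in hyperbolic space and exactly one at infinity.  Points at infinity
  are the rays of the light cone.\<close>

definition parabolic_isometry :: "real^4^4 \<Rightarrow> bool" where
  "parabolic_isometry A \<longleftrightarrow> oriented_isometry A \<and> (\<forall>x\<in>hyperboloid. A *v x \<noteq> x) \<and>
     (\<exists>p\<in>light_cone. \<forall>p'\<in>light_cone.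
        A *v p' \<in> open_ray p' \<longleftrightarrow> p' \<in> open_ray p)"

text \<open>Only orientation-preserving isometries are allowed above: a glide reflection of a horosphere also
  has a single fixed point at infinity, but no line field is invariant under all of them.\<close>

definition decorated_horosphere :: "(real^4) line_field_surface \<Rightarrow> bool" where
  "decorated_horosphere D \<longleftrightarrow> (case D of (S, l) \<Rightarrow>
     (\<exists>p\<in>light_cone. S = phi2 p) \<and>
     (\<forall>q\<in>S. \<exists>v\<in>tangent_space S q. v \<noteq> 0 \<and> l q = open_ray v) \<and> (\<forall>q. q \<notin> S \<longrightarrow> l q = {}) \<and>
     (\<forall>A. parabolic_isometry A \<and> (\<lambda>x. A *v x) ` S = S \<longrightarrow>
        (\<forall>q\<in>S. l (A *v q) = (\<lambda>v. A *v v) ` l q)))"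


section \<open>Ball model and upper half space model\<close>

type_synonym point3 = "real \<times> real \<times> real"

definition hyp_ball :: "point3 set" where
  "hyp_ball = ball 0 1"

definition ball_metric :: "point3 \<Rightarrow> point3 \<Rightarrow> point3 \<Rightarrow> real" where
  "ball_metric p v w = 4 * (v \<bullet> w) / (1 - p \<bullet> p)\<^sup>2"

definition height :: "point3 \<Rightarrow> real" where
  "height q = snd (snd q)"

definition upper_half_space :: "point3 set" where
  "upper_half_space = {q. height q > 0}"

definition uhs_metric :: "point3 \<Rightarrow> point3 \<Rightarrow> point3 \<Rightarrow> real" where
  "uhs_metric q v w = (v \<bullet> w) / (height q)\<^sup>2"

definition riemannian_isometry ::
  "'a::real_normed_vector set \<Rightarrow> ('a \<Rightarrow> 'a \<Rightarrow> 'a \<Rightarrow> real) \<Rightarrow>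
   'b::real_normed_vector set \<Rightarrow> ('b \<Rightarrow> 'b \<Rightarrow> 'b \<Rightarrow> real) \<Rightarrow> ('a \<Rightarrow> 'b) \<Rightarrow> bool" where
  "riemannian_isometry M g N h f \<longleftrightarrow> bij_betw f M N \<and>
     (\<forall>p\<in>M. \<exists>f'. (f has_derivative f') (at p) \<and> (\<forall>v w. h (f p) (f' v) (f' w) = g p v w))"

definition ball_of_hyperboloid :: "real^4 \<Rightarrow> point3" where
  "ball_of_hyperboloid x = (1 / (1 + x$1)) *\<^sub>R (x$2, x$3, x$4)"

text \<open>The boundary \<open>\<complex> \<union> {\<infinity>}\<close> of upper half space.\<close>

datatype boundary_point = Finite complex | Infinity

definition horizontal :: "complex \<Rightarrow> point3" where
  "horizontal w = (Re w, Im w, 0)"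

definition tends_to_boundary :: "('a \<Rightarrow> point3) \<Rightarrow> boundary_point \<Rightarrow> 'a filter \<Rightarrow> bool" where
  "tends_to_boundary f b F \<longleftrightarrow> (case b of
     Finite c \<Rightarrow> (f \<longlongrightarrow> horizontal c) F | Infinity \<Rightarrow> filterlim f at_infinity F)"

definition stereographic :: "point3 \<Rightarrow> boundary_point" where
  "stereographic p = (case p of (x, y, z) \<Rightarrow>
     if z = 1 then Infinity else Finite (Complex x y / of_real (1 - z)))"

text \<open>The isometry from the ball to upper half space extending the map \<open>stereographic\<close> of the
  boundary spheres (it exists by \<open>ball_to_uhs_exists\<close>; its values outside the ball are irrelevant).\<close>

definition is_ball_to_uhs :: "(point3 \<Rightarrow> point3) \<Rightarrow> bool" where
  "is_ball_to_uhs G \<longleftrightarrow>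
     riemannian_isometry hyp_ball ball_metric upper_half_space uhs_metric G \<and>
     (\<forall>b\<in>sphere 0 1. tends_to_boundary G (stereographic b) (at b within hyp_ball))"

definition push_forward ::
  "('a::real_normed_vector \<Rightarrow> 'b::real_normed_vector) \<Rightarrow> 'a line_field_surface \<Rightarrow> 'b line_field_surface" where
  "push_forward f D = (case D of (S, l) \<Rightarrow>
     (f ` S, \<lambda>y. \<Union>q\<in>{q\<in>S. f q = y}. frechet_derivative f (at q) ` l q))"

definition to_uhs ::
  "(point3 \<Rightarrow> point3) \<Rightarrow> (real^4) line_field_surface \<Rightarrow> point3 line_field_surface" where
  "to_uhs G D = push_forward (G \<circ> ball_of_hyperboloid) D"


section \<open>Horospheres in upper half space\<close>

definition at_boundary :: "point3 set \<Rightarrow> boundary_point set" where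
  "at_boundary S = {b. case b of Finite c \<Rightarrow> horizontal c \<in> closure S | Infinity \<Rightarrow> \<not> bounded S}"

definition has_centre :: "point3 line_field_surface \<Rightarrow> boundary_point \<Rightarrow> bool" where
  "has_centre D b \<longleftrightarrow> at_boundary (fst D) = {b}"

definition has_height :: "point3 line_field_surface \<Rightarrow> real \<Rightarrow> bool" where
  "has_height D h \<longleftrightarrow> fst D = {q. height q = h}"

definition specified_by :: "point3 line_field_surface \<Rightarrow> complex \<Rightarrow> bool" where
  "specified_by D w \<longleftrightarrow> w \<noteq> 0 \<and> (\<forall>q\<in>fst D. snd D q = open_ray (horizontal w))"

definition north_pole :: "point3 set \<Rightarrow> point3 \<Rightarrow> bool" where
  "north_pole S n \<longleftrightarrow> n \<in> S \<and> (\<forall>q\<in>S. q \<noteq> n \<longrightarrow> height q < height n)"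

definition has_euclidean_diameter :: "point3 line_field_surface \<Rightarrow> real \<Rightarrow> bool" where
  "has_euclidean_diameter D d \<longleftrightarrow> (\<exists>n. north_pole (fst D) n \<and> height n = d)"

definition north_pole_specified_by :: "point3 line_field_surface \<Rightarrow> complex \<Rightarrow> bool" where
  "north_pole_specified_by D w \<longleftrightarrow>
     w \<noteq> 0 \<and> (\<exists>n. north_pole (fst D) n \<and> snd D n = open_ray (horizontal w))"


section \<open>Consistency of the definitions\<close>

lemma vector_4 [simp]:
  "(vector [a, b, c, d] :: 'a::zero^4)$1 = a"
  "(vector [a, b, c, d] :: 'a::zero^4)$2 = b"
  "(vector [a, b, c, d] :: 'a::zero^4)$3 = c"
  "(vector [a, b, c, d] :: 'a::zero^4)$4 = d"
  unfolding vector_def by simp_all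

lemma herm_of_mink_inverse: "mink_of_herm (herm_of_mink x) = x"
  by (simp add: mink_of_herm_def herm_of_mink_def vec_eq_iff forall_4 field_simps)

lemma mink_of_herm_inverse:
  assumes "\<And>i j. M$i$j = cnj (M$j$i)"
  shows "herm_of_mink (mink_of_herm M) = M"
proof -
  have "Im (M$1$1) = 0" "Im (M$2$2) = 0" "M$2$1 = cnj (M$1$2)"
    using assms[of 1 1] assms[of 2 2] assms[of 2 1] by (auto simp: complex_eq_iff)
  then show ?thesis
    by (simp add: mink_of_herm_def herm_of_mink_def vec_eq_iff forall_2 complex_eq_iff field_simps)
qed

lemma linear_mink_of_herm: "linear mink_of_herm"
  by (rule linearI)
     (simp_all add: mink_of_herm_def vec_eq_iff forall_4 algebra_simps)

lemma bounded_bilinear_outer: "bounded_bilinear outer"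
proof -
  have "bilinear outer"
    unfolding bilinear_def outer_def
    by (auto intro!: linearI simp: vec_eq_iff algebra_simps)
  then show ?thesis
    by (simp add: bilinear_conv_bounded_bilinear)
qed

lemma has_derivative_phi1: "(phi1 has_derivative D_phi1 \<kappa>) (at \<kappa>)"
proof -
  have "((\<lambda>x. outer x x) has_derivative (\<lambda>h. outer \<kappa> h + outer h \<kappa>)) (at \<kappa>)"
    by (rule bounded_bilinear.FDERIV[OF bounded_bilinear_outer has_derivative_ident has_derivative_ident])
  from bounded_linear.has_derivative[OF linear_linear[THEN iffD2, OF linear_mink_of_herm, simplified] this]
  show ?thesis
    by (simp add: phi1_def[abs_def] D_phi1_def[abs_def])
qed

lemma phi1_in_light_cone:
  assumes "\<kappa> \<noteq> 0"
  shows "phi1 \<kappa> \<in> light_cone"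
proof -
  obtain a b c d where k: "\<kappa>$1 = Complex a b" "\<kappa>$2 = Complex c d"
    by (metis complex.exhaust)
  have "a \<noteq> 0 \<or> b \<noteq> 0 \<or> c \<noteq> 0 \<or> d \<noteq> 0"
    using assms k by (auto simp: vec_eq_iff forall_2 complex_eq_iff)
  then have "a\<^sup>2 + b\<^sup>2 + (c\<^sup>2 + d\<^sup>2) > 0"
    by (smt (verit) zero_le_power2 zero_less_power2)
  then show ?thesis
    by (simp add: light_cone_def mink_def phi1_def mink_of_herm_def outer_def k power2_eq_square)
       (simp add: algebra_simps)
qed

lemma mink_phi1_D_phi1:
  "mink (D_phi1 \<kappa> (Z_map \<kappa>)) (phi1 \<kappa>) = 0"
  "mink (D_phi1 \<kappa> (Z_map \<kappa>)) (D_phi1 \<kappa> (Z_map \<kappa>)) = - 4 * (phi1 \<kappa> $ 1)\<^sup>2"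
proof -
  obtain a b c d where k: "\<kappa>$1 = Complex a b" "\<kappa>$2 = Complex c d"
    by (metis complex.exhaust)
  show "mink (D_phi1 \<kappa> (Z_map \<kappa>)) (phi1 \<kappa>) = 0"
    by (simp add: mink_def phi1_def D_phi1_def Z_map_def mink_of_herm_def outer_def k)
       (simp add: algebra_simps)
  show "mink (D_phi1 \<kappa> (Z_map \<kappa>)) (D_phi1 \<kappa> (Z_map \<kappa>)) = - 4 * (phi1 \<kappa> $ 1)\<^sup>2"
    by (simp add: mink_def phi1_def D_phi1_def Z_map_def mink_of_herm_def outer_def k power2_eq_square)
       (simp add: algebra_simps)
qed

lemma Z_map_transverse:
  assumes "\<kappa> \<noteq> 0"
  shows "\<kappa> + s *\<^sub>R Z_map \<kappa> \<noteq> 0"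
proof
  assume *: "\<kappa> + s *\<^sub>R Z_map \<kappa> = 0"
  obtain a b c d where k: "\<kappa>$1 = Complex a b" "\<kappa>$2 = Complex c d"
    by (metis complex.exhaust)
  have e: "a + s * d = 0" "b + s * c = 0" "c - s * b = 0" "d - s * a = 0"
    using * k by (auto simp: vec_eq_iff forall_2 complex_eq_iff Z_map_def)
  have "a * (1 + s\<^sup>2) = 0" "b * (1 + s\<^sup>2) = 0"
    using e by algebra+
  moreover have "1 + s\<^sup>2 \<noteq> 0"
    by (smt (verit) zero_le_power2)
  ultimately have "a = 0" "b = 0" by auto
  then have "\<kappa> = 0"
    using e k by (simp add: vec_eq_iff forall_2 complex_eq_iff)
  with assms show False by simp
qed

lemma tangent_light_cone:
  assumes "\<kappa> \<noteq> 0"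
  shows "a *\<^sub>R phi1 \<kappa> + b *\<^sub>R D_phi1 \<kappa> (Z_map \<kappa>) \<in> tangent_space light_cone (phi1 \<kappa>)"
proof -
  define c where "c t = exp (a * t) *\<^sub>R phi1 (\<kappa> + (t * b) *\<^sub>R Z_map \<kappa>)" for t
  have cone: "r *\<^sub>R x \<in> light_cone" if "r > 0" "x \<in> light_cone" for r x
  proof -
    have "mink (r *\<^sub>R x) (r *\<^sub>R x) = r\<^sup>2 * mink x x"
      by (simp add: mink_def power2_eq_square algebra_simps)
    then show ?thesis using that by (simp add: light_cone_def)
  qed
  have mem: "c t \<in> light_cone" for t
    unfolding c_def using Z_map_transverse[OF assms] by (intro cone phi1_in_light_cone) auto
  have lin: "linear (D_phi1 \<kappa>)"
    using has_derivative_phi1 has_derivative_linear by blast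
  have 1: "((\<lambda>t. \<kappa> + (t * b) *\<^sub>R Z_map \<kappa>) has_derivative (\<lambda>t. (t * b) *\<^sub>R Z_map \<kappa>)) (at 0)"
    by (auto intro!: derivative_eq_intros)
  have 2: "((\<lambda>t. phi1 (\<kappa> + (t * b) *\<^sub>R Z_map \<kappa>)) has_derivative
            (\<lambda>t. D_phi1 \<kappa> ((t * b) *\<^sub>R Z_map \<kappa>))) (at 0)"
    using has_derivative_compose[OF 1, of phi1 "D_phi1 \<kappa>"] has_derivative_phi1[of \<kappa>] by simp
  have "(c has_vector_derivative (a *\<^sub>R phi1 \<kappa> + b *\<^sub>R D_phi1 \<kappa> (Z_map \<kappa>))) (at 0)"
    unfolding has_vector_derivative_def c_def[abs_def]
    by (rule derivative_eq_intros 2 refl | simp)+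
       (simp add: fun_eq_iff linear_cmul[OF lin] algebra_simps)
  then show ?thesis
    unfolding tangent_space_def using mem by (auto intro!: exI[of _ c] simp: c_def)
qed

lemma Phi1_in_flags:
  assumes "\<kappa> \<noteq> 0"
  shows "Phi1 \<kappa> \<in> flags"
proof -
  let ?p = "phi1 \<kappa>" and ?v = "D_phi1 \<kappa> (Z_map \<kappa>)"
  have p: "?p \<in> light_cone" by (rule phi1_in_light_cone[OF assms])
  have comb: "mink (a *\<^sub>R x + b *\<^sub>R y) z = a * mink x z + b * mink y z" for a b x y z
    by (simp add: mink_def algebra_simps)
  have nv: "?v \<notin> span {?p}"
  proof
    assume "?v \<in> span {?p}"
    then obtain c where "?v = c *\<^sub>R ?p" by (auto simp: span_singleton)
    then have "mink ?v ?v = c * mink ?v ?p"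
      using comb[of c ?p 0 0] by (simp add: mink_def algebra_simps)
    then show False
      using mink_phi1_D_phi1[of \<kappa>] p by (simp add: light_cone_def)
  qed
  have p0: "?p \<noteq> 0" using p by (auto simp: light_cone_def)
  have "independent {?v, ?p}"
    using nv p0 by (simp add: independent_insert)
  moreover have "?v \<noteq> ?p" using nv by (metis insertI1 span_base)
  ultimately have "dim (span {?p, ?v}) = 2"
    by (simp add: dim_span dim_eq_card_independent insert_commute)
  moreover have "u \<in> tangent_space light_cone ?p \<and> mink u ?p = 0" if "u \<in> span {?p, ?v}" for u
  proof -
    from that obtain a b where "u = a *\<^sub>R ?p + b *\<^sub>R ?v"
      by (auto simp: span_insert span_singleton) (metis add.commute diff_add_cancel)
    then show ?thesis
      using tangent_light_cone[OF assms] comb mink_phi1_D_phi1(1)[of \<kappa>] p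
      by (simp add: light_cone_def)
  qed
  moreover have "?p \<in> span {?p, ?v}" "?v \<in> span {?p, ?v}" by (auto intro: span_base)
  ultimately show ?thesis
    unfolding flags_def Phi1_def flag_of_def using p nv by blast
qed

text \<open>The isometry as an inversion in a sphere centred at the north pole \<open>(0, 0, 1)\<close>, followed by a
  reflection.\<close>

definition reflect_z :: "point3 \<Rightarrow> point3" where
  "reflect_z q = (case q of (x, y, z) \<Rightarrow> (x, y, - z))"

definition inversion :: "point3 \<Rightarrow> point3" where
  "inversion u = (2 / (u \<bullet> u)) *\<^sub>R u"

definition explicit_ball_to_uhs :: "point3 \<Rightarrow> point3" where
  "explicit_ball_to_uhs p = reflect_z (inversion (p - (0, 0, 1))) - (0, 0, 1)"

lemma linear_reflect_z: "linear reflect_z"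
  by (rule linearI) (auto simp: reflect_z_def)

lemma reflect_z_inner [simp]: "reflect_z v \<bullet> reflect_z w = v \<bullet> w"
  by (auto simp: reflect_z_def inner_prod_def split: prod.splits)

lemma reflect_z_reflect_z [simp]: "reflect_z (reflect_z v) = v"
  by (auto simp: reflect_z_def split: prod.splits)

lemma inversion_inner: "u \<noteq> 0 \<Longrightarrow> inversion u \<bullet> inversion u = 4 / (u \<bullet> u)"
  by (simp add: inversion_def)

lemma inversion_nonzero: "u \<noteq> 0 \<Longrightarrow> inversion u \<noteq> 0"
  by (simp add: inversion_def)

lemma inversion_inversion [simp]: "inversion (inversion u) = u"
proof (cases "u = 0")
  case False
  then have "u \<bullet> u \<noteq> 0" by simp
  then show ?thesis by (simp add: inversion_def)
qed (simp add: inversion_def)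

lemma height_explicit:
  assumes "p \<noteq> (0, 0, 1)"
  shows "height (explicit_ball_to_uhs p) =
    (1 - p \<bullet> p) / ((p - (0, 0, 1)) \<bullet> (p - (0, 0, 1)))"
proof -
  obtain x y z where p: "p = (x, y, z)" by (cases p)
  have "(p - (0, 0, 1)) \<bullet> (p - (0, 0, 1)) \<noteq> 0"
    using assms by simp
  then show ?thesis
    by (simp add: p height_def explicit_ball_to_uhs_def reflect_z_def inversion_def inner_prod_def
        field_simps)
qed

lemma explicit_surj:
  assumes "q \<in> upper_half_space"
  shows "\<exists>p\<in>hyp_ball. explicit_ball_to_uhs p = q"
proof -
  define p where "p = inversion (reflect_z (q + (0, 0, 1))) + (0, 0, 1)"
  have q: "explicit_ball_to_uhs p = q"
    by (simp add: p_def explicit_ball_to_uhs_def)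
  have "reflect_z (q + (0, 0, 1)) \<noteq> 0"
    using assms by (cases q) (auto simp: reflect_z_def upper_half_space_def height_def zero_prod_def)
  then have ne: "p \<noteq> (0, 0, 1)"
    using inversion_nonzero by (fastforce simp: p_def)
  have "height (explicit_ball_to_uhs p) > 0"
    using assms q by (simp add: upper_half_space_def)
  moreover have "(p - (0, 0, 1)) \<bullet> (p - (0, 0, 1)) > 0"
    using ne by simp
  ultimately have "p \<bullet> p < 1"
    by (simp add: height_explicit[OF ne] zero_less_divide_iff)
  then have "p \<in> hyp_ball"
    by (simp add: hyp_ball_def norm_eq_sqrt_inner)
  with q show ?thesis by blast
qed

lemma has_derivative_explicit:
  assumes "p \<noteq> (0, 0, 1)"
  shows "(explicit_ball_to_uhs has_derivative
    (\<lambda>v. let u = p - (0, 0, 1) in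
       reflect_z ((2 / (u \<bullet> u)) *\<^sub>R v - (4 * (u \<bullet> v) / (u \<bullet> u)\<^sup>2) *\<^sub>R u))) (at p)"
proof -
  let ?u = "p - (0, 0, 1)"
  have u: "?u \<bullet> ?u \<noteq> 0" using assms by simp
  have i: "((\<lambda>p. inversion (p - (0, 0, 1))) has_derivative
      (\<lambda>v. (2 / (?u \<bullet> ?u)) *\<^sub>R v - (4 * (?u \<bullet> v) / (?u \<bullet> ?u)\<^sup>2) *\<^sub>R ?u)) (at p)"
    unfolding inversion_def using u
    apply -
    apply (rule derivative_eq_intros refl | assumption)+
    apply (rule ext)
    apply (simp add: inner_commute power2_eq_square divide_inverse)
    done
  have bl: "bounded_linear reflect_z"
    by (simp add: linear_linear linear_reflect_z)
  show ?thesis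
    unfolding explicit_ball_to_uhs_def[abs_def] Let_def
    using has_derivative_diff[OF bounded_linear.has_derivative[OF bl i] has_derivative_const[of "(0, 0, 1)"]]
    by simp
qed

lemma ball_to_uhs_exists: "is_ball_to_uhs explicit_ball_to_uhs"
proof -
  let ?E = explicit_ball_to_uhs and ?N = "(0, 0, 1) :: point3"
  have nN: "norm ?N = 1" by (simp add: norm_Pair)
  have ne: "p \<noteq> ?N" if "p \<in> hyp_ball" for p
    using that nN by (auto simp: hyp_ball_def)
  have ball: "p \<bullet> p < 1" if "p \<in> hyp_ball" for p
    using that by (simp add: hyp_ball_def norm_eq_sqrt_inner)
  have upos: "(p - ?N) \<bullet> (p - ?N) > 0" if "p \<noteq> ?N" for p
    using that by simp
  have "inj ?E"
  proof (rule injI)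
    fix p q assume "?E p = ?E q"
    then have "reflect_z (inversion (p - ?N)) = reflect_z (inversion (q - ?N))"
      by (simp add: explicit_ball_to_uhs_def)
    then have "inversion (inversion (p - ?N)) = inversion (inversion (q - ?N))"
      by (metis reflect_z_reflect_z)
    then show "p = q" by simp
  qed
  moreover have "?E p \<in> upper_half_space" if "p \<in> hyp_ball" for p
    using height_explicit[OF ne[OF that]] ball[OF that] upos[OF ne[OF that]]
    by (simp add: upper_half_space_def)
  ultimately have bij: "bij_betw ?E hyp_ball upper_half_space"
    unfolding bij_betw_def using explicit_surj
    by (intro conjI subset_antisym subsetI; (elim imageE)?) (auto intro: inj_on_subset, metis image_eqI)
  have metric: "\<exists>f'. (?E has_derivative f') (at p) \<and>
      (\<forall>v w. uhs_metric (?E p) (f' v) (f' w) = ball_metric p v w)" if "p \<in> hyp_ball" for p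
  proof -
    define u where "u = p - ?N"
    define f' where "f' v = reflect_z ((2 / (u \<bullet> u)) *\<^sub>R v - (4 * (u \<bullet> v) / (u \<bullet> u)\<^sup>2) *\<^sub>R u)" for v
    have u: "u \<bullet> u \<noteq> 0" using ne[OF that] by (simp add: u_def)
    have "(?E has_derivative f') (at p)"
      using has_derivative_explicit[OF ne[OF that]] by (simp add: f'_def[abs_def] u_def Let_def)
    moreover have "uhs_metric (?E p) (f' v) (f' w) = ball_metric p v w" for v w
    proof -
      define s where "s = u \<bullet> u"
      have s: "s \<noteq> 0" using u by (simp add: s_def)
      have "f' v \<bullet> f' w = 4 / s\<^sup>2 * (v \<bullet> w)"
      proof -
        have "f' v \<bullet> f' w = (2 / s) * (2 / s) * (v \<bullet> w) - (2 / s) * (4 * (u \<bullet> w) / s\<^sup>2) * (u \<bullet> v)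
            - (4 * (u \<bullet> v) / s\<^sup>2) * (2 / s) * (u \<bullet> w)
            + (4 * (u \<bullet> v) / s\<^sup>2) * (4 * (u \<bullet> w) / s\<^sup>2) * (u \<bullet> u)"
          unfolding f'_def reflect_z_inner s_def[symmetric] inner_diff_left inner_diff_right
            inner_scaleR_left inner_scaleR_right inner_commute[of v u]
          by (simp only: algebra_simps)
        also have "\<dots> = 4 / s\<^sup>2 * (v \<bullet> w)"
          unfolding s_def[symmetric] using s by (simp add: power2_eq_square divide_simps)
        finally show ?thesis .
      qed
      moreover have "height (?E p) = (1 - p \<bullet> p) / s"
        using height_explicit[OF ne[OF that]] by (simp add: s_def u_def)
      ultimately show ?thesis
        using s ball[OF that] by (simp add: uhs_metric_def ball_metric_def power_divide)
    qed
    ultimately show ?thesis by blast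
  qed
  have bdry: "tends_to_boundary ?E (stereographic b) (at b within hyp_ball)" if b: "b \<in> sphere 0 1" for b
  proof (cases "b = ?N")
    case True
    have inv: "filterlim (\<lambda>p. reflect_z (inversion (p - ?N))) at_infinity (at ?N within hyp_ball)"
    proof -
      have n: "norm (reflect_z (inversion (p - ?N))) = 2 * inverse (norm (p - ?N))" for p
      proof -
        have "norm (reflect_z (inversion (p - ?N))) = norm (inversion (p - ?N))"
          by (simp add: norm_eq_sqrt_inner)
        also have "\<dots> = 2 / (norm (p - ?N))\<^sup>2 * norm (p - ?N)"
          by (simp add: inversion_def power2_norm_eq_inner)
        finally show ?thesis by (simp add: power2_eq_square field_simps)
      qed
      have "((\<lambda>p. norm (p - ?N)) \<longlongrightarrow> norm (?N - ?N)) (at ?N within hyp_ball)"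
        by (intro tendsto_intros)
      then have "((\<lambda>p. norm (p - ?N)) \<longlongrightarrow> 0) (at ?N within hyp_ball)"
        by simp
      moreover have "\<forall>\<^sub>F p in at ?N within hyp_ball. norm (p - ?N) > 0"
        by (auto simp: eventually_at intro!: exI[of _ 1])
      ultimately have "filterlim (\<lambda>p. inverse (norm (p - ?N))) at_top (at ?N within hyp_ball)"
        by (rule filterlim_inverse_at_top)
      then have "filterlim (\<lambda>p. 2 * inverse (norm (p - ?N))) at_top (at ?N within hyp_ball)"
        by (intro filterlim_tendsto_pos_mult_at_top[OF tendsto_const]) auto
      then show ?thesis
        unfolding n[symmetric] by (rule filterlim_norm_at_top_imp_at_infinity)
    qed
    have "filterlim (\<lambda>p. - ?N + reflect_z (inversion (p - ?N))) at_infinity (at ?N within hyp_ball)"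
      by (rule tendsto_add_filterlim_at_infinity[OF tendsto_const inv])
    moreover have "?E = (\<lambda>p. - ?N + reflect_z (inversion (p - ?N)))"
      unfolding explicit_ball_to_uhs_def[abs_def] by (simp only: diff_conv_add_uminus add.commute)
    ultimately show ?thesis
      using True by (simp add: tends_to_boundary_def stereographic_def)
  next
    case False
    obtain x y z where bxyz: "b = (x, y, z)" by (cases b)
    have r: "x\<^sup>2 + y\<^sup>2 + z\<^sup>2 = 1"
      using b by (simp add: bxyz norm_Pair)
    have z: "z \<noteq> 1"
      using False r by (auto simp: bxyz)
    have "?E b = horizontal (Complex x y / of_real (1 - z))"
    proof -
      have "(b - ?N) \<bullet> (b - ?N) = 2 * (1 - z)"
        using r by (simp add: bxyz inner_prod_def power2_eq_square algebra_simps)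
      then show ?thesis
        using z by (simp add: bxyz explicit_ball_to_uhs_def inversion_def reflect_z_def horizontal_def
            Re_divide_of_real Im_divide_of_real del: of_real_diff)
           (simp add: field_simps)
    qed
    moreover have "isCont ?E b"
      using has_derivative_explicit[OF False] has_derivative_continuous by blast
    ultimately show ?thesis
      using z by (auto simp: tends_to_boundary_def stereographic_def bxyz isCont_def
          intro: tendsto_within_subset)
  qed
  show ?thesis
    unfolding is_ball_to_uhs_def riemannian_isometry_def using bij metric bdry by blast
qed

end

theory Submission
  imports Defs
begin

text \<open>
  The proof has three independent parts.

  \<^bold>\<open>The model change is forced.\<close>  The isometry from the ball to upper half space is only given by its
  properties, so its values must be derived from them.  Composed with the stereographic projection
  of the hyperboloid, the expected map is \<open>(T, X, Y, Z) \<mapsto> (X, Y, 1) / (T - Z)\<close>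
  (\<open>uhs_of_hyperboloid\<close>).  Any two isometries \<open>G\<close> and \<open>E\<close> with the prescribed boundary values induce the same
  distance function on the ball.  In upper half space the distance between \<open>P\<close> and \<open>Q\<close> is a function of
  \<open>|P - Q|\<^sup>2 / (P\<^sub>z Q\<^sub>z)\<close>; letting one of the two points run to a boundary point \<open>a\<close> and then the other to
  infinity shows that \<open>|G b - a|\<^sup>2 = k |E b - a|\<^sup>2\<close> with a factor \<open>k\<close> independent of \<open>a\<close>, and this forces
  \<open>G b = E b\<close> (\<open>ball_to_uhs_unique\<close>).  That a pointwise infinitesimal isometry preserves distances is
  proved along geodesics; applied to \<open>G\<close> after the inverse of \<open>E\<close> it needs the differentiability of an
  inverse, which comes from invariance of domain.

  \<^bold>\<open>Flags give decorated horospheres.\<close>  The line field of the flag \<open>[[p, v]]\<close> at the point \<open>q\<close> of its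
  horosphere is directed by \<open>v - \<langle>v, q\<rangle> p\<close> (\<open>Phi2_flag_of\<close>).  An isometry that preserves the horosphere
  fixes \<open>p\<close> and acts on the Euclidean plane \<open>p\<^sup>\<bottom> / \<real>p\<close> by a rotation.  If this rotation were not trivial, the
  induced motion of the horosphere would have a fixed point; so a parabolic isometry moves \<open>v\<close> only by a
  multiple of \<open>p\<close>, which is what invariance of the line field means (\<open>decorated_horosphere_Phi2\<close>).

  \<^bold>\<open>Coordinates.\<close>  In upper half space the equation of the horosphere of the spinor \<open>(\<xi>, \<eta>)\<close> is
  \<open>|\<eta> w - \<xi>|\<^sup>2 + |\<eta>|\<^sup>2 z\<^sup>2 = z\<close> (\<open>mink_hyperboloid_of_uhs_phi1\<close>), from which centre, height and diameter are
  read off.  The direction of the decoration is the image of \<open>v - \<langle>v, q\<rangle> p\<close> under the derivative of the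
  model change, at any point \<open>q\<close> if \<open>\<eta> = 0\<close> and at the north pole otherwise.
\<close>

section \<open>The hyperboloid and upper half space\<close>

definition uhs_of_hyperboloid :: "real^4 \<Rightarrow> point3" where
  "uhs_of_hyperboloid x = (x$2 / (x$1 - x$4), x$3 / (x$1 - x$4), 1 / (x$1 - x$4))"

text \<open>The Hermitian matrix of this vector is \<open>1 / (2 z)\<close> times the matrix with rows \<open>(|w|\<^sup>2 +
  z\<^sup>2, w)\<close> and \<open>(cnj w, 1)\<close>, where \<open>w = x + y i\<close>.\<close>

definition hyperboloid_of_uhs :: "point3 \<Rightarrow> real^4" where
  "hyperboloid_of_uhs q = (case q of (x, y, z) \<Rightarrow>
     vector [(x\<^sup>2 + y\<^sup>2 + z\<^sup>2 + 1) / (2 * z), x / z, y / z, (x\<^sup>2 + y\<^sup>2 + z\<^sup>2 - 1) / (2 * z)])"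

text \<open>The hyperbolic cosine of the distance in upper half space, see \<open>mink_hyperboloid_of_uhs\<close>.\<close>

definition cosh_dist :: "point3 \<Rightarrow> point3 \<Rightarrow> real" where
  "cosh_dist p q = 1 + (p - q) \<bullet> (p - q) / (2 * height p * height q)"

lemma mink_add_left: "mink (x + y) z = mink x z + mink y z"
  and mink_add_right: "mink z (x + y) = mink z x + mink z y"
  and mink_diff_left: "mink (x - y) z = mink x z - mink y z"
  and mink_diff_right: "mink z (x - y) = mink z x - mink z y"
  and mink_minus_left: "mink (- x) z = - mink x z"
  and mink_minus_right: "mink z (- x) = - mink z x"
  and mink_scaleR_left: "mink (r *\<^sub>R x) z = r * mink x z"
  and mink_scaleR_right: "mink z (r *\<^sub>R x) = r * mink z x"
  by (simp_all add: mink_def algebra_simps)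

lemmas mink_simps = mink_add_left mink_add_right mink_diff_left mink_diff_right
  mink_minus_left mink_minus_right
  mink_scaleR_left mink_scaleR_right

lemma mink_zero: "mink 0 x = 0" "mink x 0 = 0"
  by (simp_all add: mink_def)

lemma mink_commute: "mink x y = mink y x"
  by (simp add: mink_def mult.commute)

lemma hyperboloid_pos:
  assumes "x \<in> hyperboloid"
  shows "x$1 - x$4 > 0" "x$1 + x$4 > 0"
proof -
  have "(x$4)\<^sup>2 < (x$1)\<^sup>2"
    using assms zero_le_power2[of "x$2"] zero_le_power2[of "x$3"]
    unfolding hyperboloid_def mink_def mem_Collect_eq power2_eq_square by linarith
  then have "\<bar>x$4\<bar> < \<bar>x$1\<bar>"
    by (metis linorder_not_less abs_le_square_iff)
  with assms have "\<bar>x$4\<bar> < x$1"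
    by (simp add: hyperboloid_def)
  then show "x$1 - x$4 > 0" "x$1 + x$4 > 0" by auto
qed

lemma hyperboloid_of_uhs_in:
  assumes "height q > 0"
  shows "hyperboloid_of_uhs q \<in> hyperboloid"
proof -
  obtain x y z where q: "q = (x, y, z)" by (cases q)
  have z: "z > 0" using assms by (simp add: q height_def)
  have "x\<^sup>2 + y\<^sup>2 + z\<^sup>2 + 1 > 0"
    using zero_le_power2[of x] zero_le_power2[of y] zero_le_power2[of z] by linarith
  then show ?thesis using z
    by (simp add: q hyperboloid_def hyperboloid_of_uhs_def mink_def field_simps)
      (simp add: power2_eq_square algebra_simps)
qed

lemma uhs_of_hyperboloid_of_uhs:
  assumes "height q > 0"
  shows "uhs_of_hyperboloid (hyperboloid_of_uhs q) = q"
proof -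
  obtain x y z where q: "q = (x, y, z)" by (cases q)
  have z: "z > 0" using assms by (simp add: q height_def)
  have "(x\<^sup>2 + y\<^sup>2 + z\<^sup>2 + 1) / (2 * z) - (x\<^sup>2 + y\<^sup>2 + z\<^sup>2 - 1) / (2 * z) = 1 / z"
    using z by (simp add: field_simps)
  then show ?thesis using z
    by (simp add: q uhs_of_hyperboloid_def hyperboloid_of_uhs_def)
qed

lemma hyperboloid_of_uhs_of_hyperboloid:
  assumes "x \<in> hyperboloid"
  shows "hyperboloid_of_uhs (uhs_of_hyperboloid x) = x"
proof -
  define s where "s = x$1 - x$4"
  have s: "s > 0" using hyperboloid_pos[OF assms] by (simp add: s_def)
  have 4: "x$4 = x$1 - s" by (simp add: s_def)
  have "x$1 * x$1 - x$2 * x$2 - x$3 * x$3 - x$4 * x$4 = 1"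
    using assms by (simp add: hyperboloid_def mink_def)
  then have e: "(x$2)\<^sup>2 + (x$3)\<^sup>2 + 1 = s * (2 * x$1 - s)"
    unfolding 4 by (simp add: power2_eq_square algebra_simps)
  have "(x$2 / s)\<^sup>2 + (x$3 / s)\<^sup>2 + (1 / s)\<^sup>2 = ((x$2)\<^sup>2 + (x$3)\<^sup>2 + 1) / s\<^sup>2"
    by (simp add: power_divide add_divide_distrib)
  also have "\<dots> = (2 * x$1 - s) / s"
    unfolding e using s by (simp add: power2_eq_square)
  finally have f: "(x$2 / s)\<^sup>2 + (x$3 / s)\<^sup>2 + (1 / s)\<^sup>2 = (2 * x$1 - s) / s" .
  show ?thesis
    unfolding uhs_of_hyperboloid_def s_def[symmetric] hyperboloid_of_uhs_def prod.case f
    using s by (simp add: vec_eq_iff forall_4 4 field_simps)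
qed

lemma height_uhs_of_hyperboloid: "height (uhs_of_hyperboloid x) = 1 / (x$1 - x$4)"
  by (simp add: height_def uhs_of_hyperboloid_def)

lemma mink_hyperboloid_of_uhs:
  assumes "height p > 0" "height q > 0"
  shows "mink (hyperboloid_of_uhs p) (hyperboloid_of_uhs q) = cosh_dist p q"
proof -
  obtain x y z x' y' z' where pq: "p = (x, y, z)" "q = (x', y', z')" by (cases p, cases q)
  have z: "z > 0" "z' > 0" using assms by (auto simp: pq height_def)
  then show ?thesis
    by (simp add: pq cosh_dist_def hyperboloid_of_uhs_def mink_def height_def inner_prod_def power2_eq_square divide_simps)
      (simp add: algebra_simps)
qed

text \<open>The derivative of \<open>uhs_of_hyperboloid\<close> at \<open>x\<close> in direction \<open>v\<close>.\<close>

definition D_uhs :: "real^4 \<Rightarrow> real^4 \<Rightarrow> point3" where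
  "D_uhs x v = (let s = x$1 - x$4; \<sigma> = v$1 - v$4 in
     (v$2 / s - x$2 * \<sigma> / s\<^sup>2, v$3 / s - x$3 * \<sigma> / s\<^sup>2, - \<sigma> / s\<^sup>2))"

lemma has_derivative_uhs_of_hyperboloid:
  assumes "x$1 \<noteq> x$4"
  shows "(uhs_of_hyperboloid has_derivative D_uhs x) (at x)"
proof -
  have c: "((\<lambda>x::real^4. x $ i) has_derivative (\<lambda>h. h $ i)) (at x)" for i x
    by (rule bounded_linear_imp_has_derivative[OF bounded_linear_vec_nth])
  have s: "((\<lambda>y::real^4. y$1 - y$4) has_derivative (\<lambda>h. h$1 - h$4)) (at x)"
    by (intro has_derivative_diff c)
  have d: "((\<lambda>y::real^4. f y / (y$1 - y$4)) has_derivative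
      (\<lambda>h. f' h / (x$1 - x$4) - f x * (h$1 - h$4) / (x$1 - x$4)\<^sup>2)) (at x)"
    if "(f has_derivative f') (at x)" for f f'
    using has_derivative_divide'[OF that s] assms
    by (simp add: diff_divide_distrib power2_eq_square)
  show ?thesis
    using has_derivative_Pair[OF d[OF c[of 2]] has_derivative_Pair[OF d[OF c[of 3]] d[OF has_derivative_const[of 1]]]]
    by (simp add: uhs_of_hyperboloid_def[abs_def] D_uhs_def[abs_def] Let_def)
qed

text \<open>The model change is an isometry: the metric of the hyperboloid is the negative of the
  Minkowski product on tangent vectors. With \<open>s = T - Z\<close>, the conditions on \<open>x\<close> and \<open>v\<close>
  eliminate the coordinates \<open>Z\<close> of both.\<close>

lemma uhs_metric_D_uhs:
  assumes "x \<in> hyperboloid" "mink x v = 0"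
  shows "uhs_metric (uhs_of_hyperboloid x) (D_uhs x v) (D_uhs x v) = - mink v v"
proof -
  define s \<sigma> where "s = x$1 - x$4" and "\<sigma> = v$1 - v$4"
  have s: "s > 0" using hyperboloid_pos[OF assms(1)] by (simp add: s_def)
  have 4: "x$4 = x$1 - s" "v$4 = v$1 - \<sigma>" by (simp_all add: s_def \<sigma>_def)
  have 1: "x$2 * x$2 + x$3 * x$3 + 1 = s * (2 * x$1 - s)"
    using assms(1) by (simp add: hyperboloid_def mink_def 4 algebra_simps)
  have 2: "x$2 * v$2 + x$3 * v$3 = x$1 * \<sigma> + s * v$1 - s * \<sigma>"
    using assms(2) by (simp add: mink_def 4 algebra_simps)
  have "uhs_metric (uhs_of_hyperboloid x) (D_uhs x v) (D_uhs x v)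
     = (s * (v$2 / s - x$2 * \<sigma> / s\<^sup>2))\<^sup>2 + (s * (v$3 / s - x$3 * \<sigma> / s\<^sup>2))\<^sup>2 + (s * (\<sigma> / s\<^sup>2))\<^sup>2"
    unfolding uhs_metric_def height_uhs_of_hyperboloid s_def[symmetric]
    using s by (simp add: D_uhs_def Let_def inner_prod_def s_def[symmetric] \<sigma>_def[symmetric] power2_eq_square field_simps)
  also have "\<dots> = (v$2 - x$2 * (\<sigma> / s))\<^sup>2 + (v$3 - x$3 * (\<sigma> / s))\<^sup>2 + (\<sigma> / s)\<^sup>2"
    using s by (simp add: power2_eq_square right_diff_distrib)
  also have "\<dots> = v$2 * v$2 + v$3 * v$3 - 2 * (\<sigma> / s) * (x$2 * v$2 + x$3 * v$3)
      + (\<sigma> / s)\<^sup>2 * (x$2 * x$2 + x$3 * x$3 + 1)"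
    by (simp add: power2_eq_square algebra_simps)
  also have "\<dots> = v$2 * v$2 + v$3 * v$3 - 2 * \<sigma> * v$1 + \<sigma>\<^sup>2"
    unfolding 1 2 using s by (simp add: field_simps power2_eq_square)
  also have "\<dots> = - mink v v"
    by (simp add: mink_def 4 algebra_simps power2_eq_square)
  finally show ?thesis .
qed

text \<open>Geodesics of the hyperboloid are the curves \<open>cosh t x + sinh t u\<close> with \<open>u\<close> a unit tangent
  vector at \<open>x\<close>; this transports them to upper half space.\<close>

lemma geodesic_exists:
  assumes "p \<in> upper_half_space" "q \<in> upper_half_space" "p \<noteq> q"
  shows "\<exists>c L. L > 0 \<and> cosh L = cosh_dist p q \<and> c 0 = p \<and> c L = q \<and>
    (\<forall>t::real. c t \<in> upper_half_space \<and>
       (\<exists>w. (c has_vector_derivative w) (at t) \<and> uhs_metric (c t) w w = 1))"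
proof -
  let ?x = "hyperboloid_of_uhs p" and ?y = "hyperboloid_of_uhs q"
  have h: "height p > 0" "height q > 0" using assms by (auto simp: upper_half_space_def)
  have hyp: "?x \<in> hyperboloid" "?y \<in> hyperboloid" using h hyperboloid_of_uhs_in by auto
  then have xx: "mink ?x ?x = 1" and yy: "mink ?y ?y = 1" by (auto simp: hyperboloid_def)
  have xy: "mink ?x ?y = cosh_dist p q" using mink_hyperboloid_of_uhs[OF h] .
  have gt: "cosh_dist p q > 1"
    using h assms(3) by (simp add: cosh_dist_def)
  define L where "L = arcosh (cosh_dist p q)"
  have coshL: "cosh L = cosh_dist p q" using gt by (simp add: L_def cosh_arcosh_real)
  have L: "L > 0" using gt by (simp add: L_def arcosh_real_gt_1_iff)
  have S: "sinh L > 0" using L by simp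
  define u where "u = (1 / sinh L) *\<^sub>R (?y - cosh L *\<^sub>R ?x)"
  have xu: "mink ?x u = 0"
    by (simp add: u_def mink_simps xx xy coshL)
  have "mink u u = (1 / sinh L)\<^sup>2 * (1 - (cosh L)\<^sup>2)"
    by (simp add: u_def mink_simps xx xy yy coshL mink_commute[of ?y ?x] power2_eq_square algebra_simps)
  also have "\<dots> = -1"
    using S by (simp add: cosh_square_eq power_divide)
  finally have uu: "mink u u = -1" .
  define g where "g t = cosh t *\<^sub>R ?x + sinh t *\<^sub>R u" for t
  define g' where "g' t = sinh t *\<^sub>R ?x + cosh t *\<^sub>R u" for t
  have g: "(g has_vector_derivative g' t) (at t)" for t
    unfolding g_def[abs_def] g'_def by (auto intro!: derivative_eq_intros)
  have cs: "cosh t * cosh t - sinh t * sinh t = 1" for t :: real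
    using cosh_square_eq[of t] by (simp add: power2_eq_square)
  have gg: "mink (g t) (g t) = 1" "mink (g t) (g' t) = 0" "mink (g' t) (g' t) = -1" for t
    using cs[of t] by (simp_all add: g_def g'_def mink_simps xx xu uu mink_commute[of u ?x])
  have g1: "g t $ 1 > 0" for t
  proof -
    have x1: "?x $ 1 > 0" using hyp by (simp add: hyperboloid_def)
    show ?thesis
    proof (rule ccontr)
      \<comment> \<open>The curve would have to cross \<open>T = 0\<close> to reach the past sheet, but there the
        Minkowski square is not positive.\<close>
      assume "\<not> ?thesis"
      then have neg: "g t $ 1 \<le> 0" by simp
      have "continuous_on UNIV (\<lambda>t. g t $ 1)"
        unfolding g_def by (intro continuous_intros)
      moreover have "g 0 $ 1 > 0" using x1 by (simp add: g_def)
      ultimately have "\<exists>s. g s $ 1 = 0"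
        using neg IVT'[of "\<lambda>t. g t $ 1" t 0 0] IVT2'[of "\<lambda>t. g t $ 1" t 0 0]
        by (meson continuous_on_subset linear order.strict_implies_order subset_UNIV)
      then obtain s where "g s $ 1 = 0" by blast
      with gg(1)[of s] have "(g s $ 2)\<^sup>2 + (g s $ 3)\<^sup>2 + (g s $ 4)\<^sup>2 = -1"
        by (simp add: mink_def power2_eq_square)
      then show False
        by (smt (verit) zero_le_power2)
    qed
  qed
  have gH: "g t \<in> hyperboloid" for t using gg g1 by (simp add: hyperboloid_def)
  define c where "c t = uhs_of_hyperboloid (g t)" for t
  have "c 0 = p" using uhs_of_hyperboloid_of_uhs h by (simp add: c_def g_def)
  moreover have "c L = q"
    using uhs_of_hyperboloid_of_uhs h S by (simp add: c_def g_def u_def)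
  moreover have "c t \<in> upper_half_space" for t
    using hyperboloid_pos[OF gH[of t]] by (simp add: c_def upper_half_space_def height_uhs_of_hyperboloid)
  moreover have "\<exists>w. (c has_vector_derivative w) (at t) \<and> uhs_metric (c t) w w = 1" for t
  proof -
    have "(uhs_of_hyperboloid has_derivative D_uhs (g t)) (at (g t))"
      using has_derivative_uhs_of_hyperboloid hyperboloid_pos[OF gH[of t]] by force
    from vector_derivative_diff_chain_within[OF has_vector_derivative_at_within[OF g] has_derivative_at_withinI[OF this], of UNIV]
    have "(c has_vector_derivative D_uhs (g t) (g' t)) (at t)"
      by (simp add: c_def[abs_def] o_def)
    then show ?thesis
      using uhs_metric_D_uhs[OF gH gg(2), of t] gg(3)[of t] unfolding c_def[of t]
      by (intro exI[of _ "D_uhs (g t) (g' t)"]) simp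
  qed
  ultimately show ?thesis using L coshL by blast
qed

section \<open>Infinitesimal isometries preserve distances\<close>

text \<open>The gradient of \<open>cosh d\<close>, with \<open>d\<close> the distance from \<open>p\<close>, has length \<open>sinh d\<close> in the
  hyperbolic metric, which bounds the rate of change along a curve of unit speed. Here \<open>g\<close> is a
  multiple of the Euclidean gradient, and the bound is the Cauchy-Schwarz inequality.\<close>

lemma grad_cosh_dist:
  fixes w :: point3
  assumes "p \<in> upper_half_space" "q \<in> upper_half_space"
    and "(c has_vector_derivative w) (at t)" "c t = q" "uhs_metric q w w = 1"
  shows "\<exists>d. ((\<lambda>s. cosh_dist p (c s)) has_real_derivative d) (at t) \<and> d\<^sup>2 \<le> (cosh_dist p q)\<^sup>2 - 1"
proof -
  define h k where "h = height p" and "k = height q"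
  have h: "h > 0" "k > 0" using assms by (auto simp: upper_half_space_def h_def k_def)
  define N where "N = (p - q) \<bullet> (p - q)"
  define d where "d = - (2 * ((p - q) \<bullet> w) * k + N * height w) / (2 * h * k\<^sup>2)"
  have bh: "bounded_linear height"
    unfolding height_def[abs_def] by (intro bounded_linear_intros)
  have D: "((\<lambda>s. cosh_dist p (c s)) has_real_derivative d) (at t)"
  proof -
    have hc: "((\<lambda>s. height (c s)) has_real_derivative height w) (at t)"
      using bounded_linear.has_vector_derivative[OF bh assms(3)]
      by (simp add: has_real_derivative_iff_has_vector_derivative)
    have pc: "((\<lambda>s. p - c s) has_derivative (\<lambda>x. - (x *\<^sub>R w))) (at t)"
      using has_derivative_diff[OF has_derivative_const[of p] assms(3)[unfolded has_vector_derivative_def]]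
      by simp
    have Nc: "((\<lambda>s. (p - c s) \<bullet> (p - c s)) has_real_derivative (- 2 * ((p - q) \<bullet> w))) (at t)"
      unfolding has_field_derivative_def
      by (rule has_derivative_eq_rhs[OF has_derivative_inner[OF pc pc]])
         (simp add: fun_eq_iff assms(4) inner_commute[of w])
    have "((\<lambda>s. (p - c s) \<bullet> (p - c s) / (2 * h * height (c s))) has_real_derivative
       ((- 2 * ((p - q) \<bullet> w)) * (2 * h * k) - N * (2 * h * height w)) / ((2 * h * k) * (2 * h * k))) (at t)"
      using DERIV_divide[OF Nc DERIV_cmult[OF hc, of "2 * h"]] h assms(4) by (simp add: N_def k_def)
    moreover have "((- 2 * ((p - q) \<bullet> w)) * (2 * h * k) - N * (2 * h * height w)) / ((2 * h * k) * (2 * h * k)) = d"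
      using h by (simp add: d_def field_simps power2_eq_square)
    ultimately show ?thesis
      unfolding cosh_dist_def[abs_def] h_def[symmetric] using DERIV_add[OF DERIV_const[of 1]] by fastforce
  qed
  obtain x y z x' y' z' a b e where c: "p = (x, y, z)" "q = (x', y', z')" "w = (a, b, e)"
    by (cases p, cases q, cases w)
  define g :: point3 where "g = (2 * k) *\<^sub>R (p - q) + N *\<^sub>R (0, 0, 1)"
  have "d = - (g \<bullet> w) / (2 * h * k\<^sup>2)"
    by (simp add: d_def g_def height_def inner_prod_def c algebra_simps)
  then have "d\<^sup>2 = (g \<bullet> w)\<^sup>2 / (2 * h * k\<^sup>2)\<^sup>2"
    by (simp add: power_divide)
  also have "\<dots> \<le> ((g \<bullet> g) * (w \<bullet> w)) / (2 * h * k\<^sup>2)\<^sup>2"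
    by (intro divide_right_mono Cauchy_Schwarz_ineq) auto
  also have "w \<bullet> w = k\<^sup>2"
    using assms(5) h by (simp add: uhs_metric_def k_def)
  also have "g \<bullet> g = 4 * k\<^sup>2 * N + 4 * k * N * (h - k) + N\<^sup>2"
  proof -
    define e3 :: point3 where "e3 = (0, 0, 1)"
    have e3: "(p - q) \<bullet> e3 = h - k" "e3 \<bullet> e3 = 1"
      by (simp_all add: e3_def c h_def k_def height_def inner_prod_def)
    show ?thesis
      unfolding g_def e3_def[symmetric] inner_add_left inner_add_right inner_scaleR_left inner_scaleR_right
        inner_commute[of e3 "p - q"] e3 N_def[symmetric] by (simp add: power2_eq_square algebra_simps)
  qed
  also have "(4 * k\<^sup>2 * N + 4 * k * N * (h - k) + N\<^sup>2) * k\<^sup>2 / (2 * h * k\<^sup>2)\<^sup>2 = (1 + N / (2 * h * k))\<^sup>2 - 1"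
    using h by (simp add: field_simps power2_eq_square)
  also have "1 + N / (2 * h * k) = cosh_dist p q"
    by (simp add: cosh_dist_def N_def h_def k_def)
  finally show ?thesis using D by blast
qed

text \<open>By \<open>grad_cosh_dist\<close> the distance from the starting point grows at most at rate one. The
  curve is only known to be differentiable, so this is integrated by the mean value theorem.\<close>

lemma unit_speed_cosh_dist_le:
  assumes "L > 0"
    and c: "\<And>t. t \<in> {0..L} \<Longrightarrow> c t \<in> upper_half_space \<and>
       (\<exists>w. (c has_vector_derivative w) (at t) \<and> uhs_metric (c t) w w = 1)"
  shows "cosh_dist (c 0) (c L) \<le> cosh L"
proof -
  define f where "f t = cosh_dist (c 0) (c t)" for t
  have f1: "f t \<ge> 1" if "t \<in> {0..L}" for t
    using c[OF that] c[of 0] assms(1) by (simp add: f_def cosh_dist_def upper_half_space_def)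
  have df: "\<exists>d. (f has_real_derivative d) (at t) \<and> d\<^sup>2 \<le> (f t)\<^sup>2 - 1" if "t \<in> {0..L}" for t
    unfolding f_def[abs_def] using c[OF that] c[of 0] assms(1) grad_cosh_dist[of "c 0" "c t" c _ t] by auto
  have cont: "continuous_on {0..L} f"
    using df by (meson DERIV_atLeastAtMost_imp_continuous_on DERIV_isCont continuous_at_imp_continuous_on)
  show ?thesis
  proof (cases "f L = 1")
    case True then show ?thesis using cosh_real_ge_1[of L] by (simp add: f_def)
  next
    case False
    \<comment> \<open>The inverse hyperbolic cosine is not differentiable at \<open>1\<close>, so the mean value theorem is
      applied after the last time \<open>s\<close> at which the curve is at its starting point.\<close>
    define K where "K = {t \<in> {0..L}. f t = 1}"
    have "closed K"
      unfolding K_def using cont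
      by (intro continuous_closed_preimage_constant) auto
    moreover have "bounded K" by (rule bounded_subset[of "{0..L}"]) (auto simp: K_def)
    moreover have "K \<noteq> {}" using assms(1) by (auto simp: K_def f_def cosh_dist_def intro!: exI[of _ 0])
    ultimately obtain s where s: "s \<in> K" "\<And>t. t \<in> K \<Longrightarrow> t \<le> s"
      using compact_attains_sup[of K] compact_eq_bounded_closed by blast
    have sL: "s < L" "s \<ge> 0" using s False by (auto simp: K_def order.order_iff_strict)
    have gt: "f t > 1" if "s < t" "t \<le> L" for t
      using s(2)[of t] f1[of t] that sL by (force simp: K_def)
    have "\<exists>t. s < t \<and> t < L \<and> (\<exists>D. ((\<lambda>t. arcosh (f t)) has_real_derivative D) (at t) \<and>
        arcosh (f L) - arcosh (f s) = (L - s) * D \<and> D \<le> 1)"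
    proof -
      have der: "\<exists>D. ((\<lambda>t. arcosh (f t)) has_real_derivative D) (at t) \<and> D \<le> 1" if t: "s < t" "t < L" for t
      proof -
        obtain d where d: "(f has_real_derivative d) (at t)" "d\<^sup>2 \<le> (f t)\<^sup>2 - 1" using df[of t] t sL by auto
        have g: "f t > 1" using gt[of t] t by auto
        then have "(f t)\<^sup>2 - 1 > 0" by (simp add: one_less_power)
        moreover have "d \<le> sqrt ((f t)\<^sup>2 - 1)"
          using d(2) by (rule real_le_rsqrt)
        ultimately have "1 / sqrt ((f t)\<^sup>2 - 1) * d \<le> 1" by (simp add: field_simps)
        moreover have "((\<lambda>t. arcosh (f t)) has_real_derivative (1 / sqrt ((f t)\<^sup>2 - 1) * d)) (at t)"
          by (rule DERIV_chain2[OF arcosh_real_has_field_derivative[OF g] d(1)])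
        ultimately show ?thesis by blast
      qed
      have "continuous_on {s..L} (\<lambda>t. arcosh (f t))"
        using cont sL f1 by (intro continuous_on_arcosh' continuous_on_subset[OF cont]) auto
      then obtain D t where "s < t" "t < L" "((\<lambda>t. arcosh (f t)) has_real_derivative D) (at t)"
         "arcosh (f L) - arcosh (f s) = (L - s) * D"
        using MVT[of s L "\<lambda>t. arcosh (f t)"] sL der by (metis real_differentiable_def)
      with der[of t] show ?thesis by (metis DERIV_unique)
    qed
    then obtain D where D: "arcosh (f L) - arcosh (f s) = (L - s) * D" "D \<le> 1" by blast
    have "arcosh (f L) = (L - s) * D" using D s by (simp add: K_def)
    also have "\<dots> \<le> (L - s) * 1" using D sL by (intro mult_left_mono) auto
    finally have "arcosh (f L) \<le> L" using sL by simp
    then have "cosh (arcosh (f L)) \<le> cosh L"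
      using f1[of L] assms(1) by (subst cosh_real_nonneg_le_iff) auto
    then show ?thesis using f1[of L] assms(1) by (simp add: f_def)
  qed
qed

text \<open>The image of the geodesic from \<open>p\<close> to \<open>q\<close> is a curve of unit speed.\<close>

lemma riemannian_isometry_cosh_dist_le:
  assumes "riemannian_isometry upper_half_space uhs_metric upper_half_space uhs_metric K"
    and "p \<in> upper_half_space" "q \<in> upper_half_space"
  shows "cosh_dist (K p) (K q) \<le> cosh_dist p q"
proof (cases "p = q")
  case False
  then obtain c L where c: "L > 0" "cosh L = cosh_dist p q" "c 0 = p" "c L = q"
    "\<And>t::real. c t \<in> upper_half_space \<and>
       (\<exists>w. (c has_vector_derivative w) (at t) \<and> uhs_metric (c t) w w = 1)"
    using geodesic_exists[OF assms(2,3)] by metis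
  have "(K \<circ> c) t \<in> upper_half_space \<and>
       (\<exists>w. ((K \<circ> c) has_vector_derivative w) (at t) \<and> uhs_metric ((K \<circ> c) t) w w = 1)" for t
  proof -
    obtain w where w: "(c has_vector_derivative w) (at t)" "uhs_metric (c t) w w = 1" using c(5) by blast
    obtain K' where K': "(K has_derivative K') (at (c t))"
      "\<forall>v w. uhs_metric (K (c t)) (K' v) (K' w) = uhs_metric (c t) v w"
      using assms(1) c(5)[of t] unfolding riemannian_isometry_def by blast
    have "((K \<circ> c) has_vector_derivative K' w) (at t)"
      using vector_derivative_diff_chain_within[OF has_vector_derivative_at_within[OF w(1)] has_derivative_at_withinI[OF K'(1)], of UNIV] by simp
    moreover have "uhs_metric ((K \<circ> c) t) (K' w) (K' w) = 1" using K'(2)[rule_format, of w w] w(2) by simp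
    moreover have "(K \<circ> c) t \<in> upper_half_space"
      using assms(1) c(5)[of t] by (auto simp: riemannian_isometry_def bij_betw_def)
    ultimately show ?thesis by blast
  qed
  from unit_speed_cosh_dist_le[OF c(1), of "K \<circ> c", OF this] show ?thesis
    using c(2-4) by simp
qed (simp add: cosh_dist_def)

lemma riemannian_isometry_compose:
  assumes f: "riemannian_isometry L g M h f" and k: "riemannian_isometry M h N l k"
  shows "riemannian_isometry L g N l (k \<circ> f)"
  unfolding riemannian_isometry_def
proof (intro conjI ballI)
  show "bij_betw (k \<circ> f) L N"
    using f k bij_betw_trans unfolding riemannian_isometry_def by blast
  fix p assume p: "p \<in> L"
  obtain f' where f': "(f has_derivative f') (at p)" "\<And>v w. h (f p) (f' v) (f' w) = g p v w"
    using f p unfolding riemannian_isometry_def by blast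
  have "f p \<in> M" using f p by (auto simp: riemannian_isometry_def bij_betw_def)
  then obtain k' where k': "(k has_derivative k') (at (f p))" "\<And>v w. l (k (f p)) (k' v) (k' w) = h (f p) v w"
    using k unfolding riemannian_isometry_def by blast
  show "\<exists>f'. ((k \<circ> f) has_derivative f') (at p) \<and> (\<forall>v w. l ((k \<circ> f) p) (f' v) (f' w) = g p v w)"
    using diff_chain_at[OF f'(1) k'(1)] f'(2) k'(2) by (intro exI[of _ "k' \<circ> f'"]) auto
qed

text \<open>The derivative of \<open>f\<close> is not assumed to depend continuously on the point, so the inverse
  function theorem does not apply. Instead the inverse is continuous by invariance of domain,
  and a continuous inverse of a differentiable map with invertible derivative is differentiable.\<close>

lemma riemannian_isometry_inv_into:
  fixes f :: "'a::euclidean_space \<Rightarrow> 'a"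
  assumes f: "riemannian_isometry M g N h f" and M: "open M"
    and g: "\<And>p v. p \<in> M \<Longrightarrow> g p v v = 0 \<Longrightarrow> v = 0" and h: "\<And>q. h q 0 0 = 0"
  shows "riemannian_isometry N h M g (inv_into M f)"
  unfolding riemannian_isometry_def
proof (intro conjI ballI)
  have bij: "bij_betw f M N" using f by (simp add: riemannian_isometry_def)
  then show "bij_betw (inv_into M f) N M" by (rule bij_betw_inv_into)
  fix q assume q: "q \<in> N"
  define p where "p = inv_into M f q"
  have p: "p \<in> M" "f p = q"
    using bij q by (auto simp: p_def bij_betw_def inv_into_into f_inv_into_f)
  have cont: "continuous_on M f"
    using f by (intro continuous_at_imp_continuous_on) (auto simp: riemannian_isometry_def intro: has_derivative_continuous)
  have N: "open N"
    using invariance_of_domain[OF cont M] bij by (simp add: bij_betw_def)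
  have "continuous_on N (inv_into M f)"
    using continuous_on_inverse_open[OF M cont, of "inv_into M f"] bij by (auto simp: bij_betw_def)
  then have ci: "continuous (at q) (inv_into M f)"
    using N q continuous_on_eq_continuous_at by blast
  obtain f' where f': "(f has_derivative f') (at p)" "\<And>v w. h (f p) (f' v) (f' w) = g p v w"
    using f p unfolding riemannian_isometry_def by blast
  have lin: "linear f'" using f'(1) has_derivative_linear by blast
  have "v = 0" if "f' v = 0" for v
    using f'(2)[of v v] that h g[OF p(1)] by simp
  then have "inj f'" using lin linear_injective_0 by blast
  then obtain g' where g': "linear g'" "g' \<circ> f' = id" "f' \<circ> g' = id"
    using linear_injective_isomorphism[OF lin] by (auto simp: fun_eq_iff)
  have "(inv_into M f has_derivative g') (at q)"
    by (rule has_derivative_inverse_basic[OF _ _ g'(2) ci N q])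
       (use f' g' p bij in \<open>auto simp: p_def linear_linear bij_betw_def f_inv_into_f\<close>)
  moreover have "g (inv_into M f q) (g' v) (g' w) = h q v w" for v w
    using f'(2)[of "g' v" "g' w"] g'(3) p by (simp add: p_def[symmetric] fun_eq_iff)
  ultimately show "\<exists>f'. (inv_into M f has_derivative f') (at q) \<and>
        (\<forall>v w. g (inv_into M f q) (f' v) (f' w) = h q v w)" by blast
qed

text \<open>This applies \<open>riemannian_isometry_cosh_dist_le\<close> to \<open>G\<close> after the inverse of \<open>E\<close>.
  Exchanging \<open>G\<close> and \<open>E\<close> turns the inequality into an equality.\<close>

lemma ball_to_uhs_cosh_dist:
  assumes "is_ball_to_uhs G" "is_ball_to_uhs E" "b \<in> hyp_ball" "c \<in> hyp_ball"
  shows "cosh_dist (G b) (G c) \<le> cosh_dist (E b) (E c)"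
proof -
  have pd: "v = 0" if "p \<in> hyp_ball" "ball_metric p v v = 0" for p v
  proof -
    have "p \<bullet> p < 1" using that(1) by (simp add: hyp_ball_def norm_eq_sqrt_inner)
    then show ?thesis using that(2) by (simp add: ball_metric_def)
  qed
  have E: "riemannian_isometry hyp_ball ball_metric upper_half_space uhs_metric E"
    and G: "riemannian_isometry hyp_ball ball_metric upper_half_space uhs_metric G"
    using assms by (auto simp: is_ball_to_uhs_def)
  have i: "riemannian_isometry upper_half_space uhs_metric hyp_ball ball_metric (inv_into hyp_ball E)"
    by (rule riemannian_isometry_inv_into[OF E _ pd]) (auto simp: uhs_metric_def hyp_ball_def)
  have bij: "bij_betw E hyp_ball upper_half_space" using E by (simp add: riemannian_isometry_def)
  have "E b \<in> upper_half_space" "E c \<in> upper_half_space"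
    using bij assms by (auto simp: bij_betw_def)
  from riemannian_isometry_cosh_dist_le[OF riemannian_isometry_compose[OF i G] this]
  show ?thesis using bij assms by (simp add: bij_betw_def)
qed

section \<open>Uniqueness of the isometry from the ball to upper half space\<close>

lemma dist_ratio_tendsto_1:
  fixes f :: "'a \<Rightarrow> 'b::real_normed_vector"
  assumes "filterlim f at_infinity F"
  shows "((\<lambda>x. norm (f x - a) / norm (f x - b)) \<longlongrightarrow> 1) F"
proof -
  have inf: "filterlim (\<lambda>x. norm (f x - b)) at_top F"
    using filterlim_compose[OF filterlim_norm_at_top tendsto_add_filterlim_at_infinity'[OF assms tendsto_const[of "- b"]]]
    by simp
  have "((\<lambda>x. norm (a - b) / norm (f x - b)) \<longlongrightarrow> 0) F"
    by (rule real_tendsto_divide_at_top[OF tendsto_const inf])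
  then have "((\<lambda>x. norm (f x - a) / norm (f x - b) - 1) \<longlongrightarrow> 0) F"
  proof (rule Lim_null_comparison[rotated])
    have "eventually (\<lambda>x. norm (f x - b) > 0) F"
      using inf unfolding filterlim_at_top_dense by blast
    then show "eventually (\<lambda>x. norm (norm (f x - a) / norm (f x - b) - 1) \<le> norm (a - b) / norm (f x - b)) F"
    proof eventually_elim
      case (elim x)
      have "\<bar>norm (f x - a) - norm (f x - b)\<bar> \<le> norm ((f x - a) - (f x - b))"
        by (rule norm_triangle_ineq3)
      also have "\<dots> = norm (a - b)" by (simp add: norm_minus_commute)
      finally have "\<bar>norm (f x - a) - norm (f x - b)\<bar> / norm (f x - b) \<le> norm (a - b) / norm (f x - b)"
        using elim by (intro divide_right_mono) auto
      moreover have "norm (f x - a) / norm (f x - b) - 1 = (norm (f x - a) - norm (f x - b)) / norm (f x - b)"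
        using elim by (simp add: field_simps)
      ultimately show ?case by simp
    qed
  qed
  then show ?thesis by (simp add: LIM_zero_iff)
qed

text \<open>Comparing coefficients in \<open>a\<close>: both sides are quadratic polynomials in the boundary point,
  whose leading coefficients give \<open>k = 1\<close>, whose linear coefficients give the horizontal
  coordinates, and whose constant terms give the height.\<close>

lemma point_determined_by_boundary_distances:
  assumes P: "P \<in> upper_half_space" and Q: "Q \<in> upper_half_space"
    and eq: "\<And>a. (P - horizontal a) \<bullet> (P - horizontal a) = k * ((Q - horizontal a) \<bullet> (Q - horizontal a))"
  shows "P = Q"
proof -
  obtain x y z x' y' z' where pq: "P = (x, y, z)" "Q = (x', y', z')" by (cases P, cases Q)
  have z: "z > 0" "z' > 0" using P Q by (auto simp: upper_half_space_def height_def pq)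
  have e: "(x - Re a)\<^sup>2 + (y - Im a)\<^sup>2 + z\<^sup>2 = k * ((x' - Re a)\<^sup>2 + (y' - Im a)\<^sup>2 + z'\<^sup>2)" for a
    using eq[of a] by (simp add: pq horizontal_def inner_prod_def power2_eq_square algebra_simps)
  have 0: "x\<^sup>2 + y\<^sup>2 + z\<^sup>2 = k * (x'\<^sup>2 + y'\<^sup>2 + z'\<^sup>2)"
    using e[of 0] by simp
  have 1: "(x - 1)\<^sup>2 + y\<^sup>2 + z\<^sup>2 = k * ((x' - 1)\<^sup>2 + y'\<^sup>2 + z'\<^sup>2)"
    using e[of 1] by simp
  have 2: "(x + 1)\<^sup>2 + y\<^sup>2 + z\<^sup>2 = k * ((x' + 1)\<^sup>2 + y'\<^sup>2 + z'\<^sup>2)"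
    using e[of "-1"] by simp
  have 3: "x\<^sup>2 + (y - 1)\<^sup>2 + z\<^sup>2 = k * (x'\<^sup>2 + (y' - 1)\<^sup>2 + z'\<^sup>2)"
    using e[of "\<i>"] by simp
  have k: "k = 1" using 0 1 2 by (simp add: power2_eq_square algebra_simps)
  have "x = x'" "y = y'" using 0 1 3 by (simp_all add: k power2_eq_square algebra_simps)
  moreover from this have "z\<^sup>2 = z'\<^sup>2" using 0 by (simp add: k)
  ultimately show ?thesis using z by (simp add: pq)
qed

lemma ball_to_uhs_in_upper_half_space:
  "is_ball_to_uhs G \<Longrightarrow> b \<in> hyp_ball \<Longrightarrow> G b \<in> upper_half_space"
  by (auto simp: is_ball_to_uhs_def riemannian_isometry_def bij_betw_def)

lemma sphere_islimpt_hyp_ball: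
  assumes "s \<in> sphere 0 1"
  shows "at s within hyp_ball \<noteq> bot"
proof -
  have "s \<in> closure (hyp_ball)"
    using assms by (simp add: hyp_ball_def)
  moreover have "s \<notin> hyp_ball" using assms by (simp add: hyp_ball_def)
  ultimately show ?thesis
    by (simp add: trivial_limit_within islimpt_in_closure)
qed

lemma stereographic_surj_Finite: "\<exists>s\<in>sphere 0 1. stereographic s = Finite a"
proof -
  define m where "m = (Re a)\<^sup>2 + (Im a)\<^sup>2"
  have m: "m \<ge> 0" by (simp add: m_def)
  define s where "s = (2 * Re a / (m + 1), 2 * Im a / (m + 1), (m - 1) / (m + 1))"
  have "norm s = 1"
  proof -
    have "(2 * Re a / (m + 1))\<^sup>2 + (2 * Im a / (m + 1))\<^sup>2 + ((m - 1) / (m + 1))\<^sup>2 = (4 * m + (m - 1)\<^sup>2) / (m + 1)\<^sup>2"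
      by (simp add: m_def power_divide add_divide_distrib power_mult_distrib)
    also have "4 * m + (m - 1)\<^sup>2 = (m + 1)\<^sup>2" by (simp add: power2_eq_square algebra_simps)
    also have "(m + 1)\<^sup>2 / (m + 1)\<^sup>2 = 1" using m by simp
    finally show ?thesis by (simp add: s_def norm_Pair flip: abs_divide)
  qed
  moreover have "1 - (m - 1) / (m + 1) = 2 / (m + 1)" using m by (simp add: field_simps)
  then have "stereographic s = Finite a"
    using m by (simp add: s_def stereographic_def complex_eq_iff Re_divide_of_real Im_divide_of_real del: of_real_diff of_real_divide)
  ultimately show ?thesis by auto
qed

text \<open>The quantity \<open>\<Lambda> c a\<close> below is the quotient of the exponentiated Busemann functions \<open>|P -
  a|\<^sup>2 / P\<^sub>z\<close> of the boundary point \<open>a\<close> at \<open>P = G c\<close> and at \<open>P = E c\<close>. It does not depend on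
  \<open>c\<close>, because it is the limit of \<open>G\<^sub>z / E\<^sub>z\<close> at the point of the sphere over \<open>a\<close>. Hence its
  dependence on \<open>a\<close> may be tested as \<open>c\<close> tends to the north pole, where both images tend to
  infinity and the positions of boundary points cease to matter.\<close>

lemma ball_to_uhs_unique:
  assumes G: "is_ball_to_uhs G" and E: "is_ball_to_uhs E" and b: "b \<in> hyp_ball"
  shows "G b = E b"
proof -
  have hG: "height (G c) > 0" and hE: "height (E c) > 0" if "c \<in> hyp_ball" for c
    using ball_to_uhs_in_upper_half_space[OF _ that] G E by (auto simp: upper_half_space_def)
  define \<Lambda> where "\<Lambda> c a = (norm (G c - a))\<^sup>2 * height (E c) / (height (G c) * (norm (E c - a))\<^sup>2)" for c a
  have ne: "norm (G c - horizontal a) > 0" "norm (E c - horizontal a) > 0" if "c \<in> hyp_ball" for c a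
    using hG[OF that] hE[OF that] by (auto simp: height_def horizontal_def)
  have \<Lambda>_pos: "\<Lambda> c (horizontal a) > 0" if "c \<in> hyp_ball" for c a
    using hG[OF that] hE[OF that] ne[OF that] by (simp add: \<Lambda>_def)
  have eq: "(norm (G c - G d))\<^sup>2 / (height (G c) * height (G d)) = (norm (E c - E d))\<^sup>2 / (height (E c) * height (E d))"
    if "c \<in> hyp_ball" "d \<in> hyp_ball" for c d
    using ball_to_uhs_cosh_dist[OF G E that] ball_to_uhs_cosh_dist[OF E G that]
    by (simp add: cosh_dist_def power2_norm_eq_inner field_simps)
  have lim: "((\<lambda>d. height (G d) / height (E d)) \<longlongrightarrow> \<Lambda> c (horizontal a)) (at s within hyp_ball)"
    if c: "c \<in> hyp_ball" and s: "s \<in> sphere 0 1" "stereographic s = Finite a" for c s a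
  proof -
    let ?F = "at s within hyp_ball"
    have tG: "(G \<longlongrightarrow> horizontal a) ?F" and tE: "(E \<longlongrightarrow> horizontal a) ?F"
      using G E s by (force simp: is_ball_to_uhs_def tends_to_boundary_def)+
    have "((\<lambda>d. (norm (G c - G d))\<^sup>2 * height (E c) / (height (G c) * (norm (E c - E d))\<^sup>2))
       \<longlongrightarrow> \<Lambda> c (horizontal a)) ?F"
      unfolding \<Lambda>_def using tG tE ne[OF c, of a] hG[OF c]
      by (intro tendsto_intros) auto
    moreover have "eventually (\<lambda>d. (norm (G c - G d))\<^sup>2 * height (E c) / (height (G c) * (norm (E c - E d))\<^sup>2)
       = height (G d) / height (E d)) ?F"
    proof -
      have "((\<lambda>d. norm (E c - E d)) \<longlongrightarrow> norm (E c - horizontal a)) ?F"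
        using tE by (intro tendsto_intros)
      then have "eventually (\<lambda>d. norm (E c - E d) > 0) ?F"
        using ne(2)[OF c, of a] by (rule order_tendstoD(1))
      moreover have "eventually (\<lambda>d. d \<in> hyp_ball) ?F"
        by (simp add: eventually_at_filter)
      ultimately show ?thesis
      proof eventually_elim
        case (elim d)
        then show ?case
          using eq[OF c elim(2)] hG[OF c] hE[OF c] hG[OF elim(2)] hE[OF elim(2)]
          by (simp add: field_simps)
      qed
    qed
    ultimately show ?thesis by (rule Lim_transform_eventually)
  qed
  have indep_c: "\<Lambda> c (horizontal a) = \<Lambda> d (horizontal a)" if cd: "c \<in> hyp_ball" "d \<in> hyp_ball" for c d a
  proof -
    obtain s where "s \<in> sphere 0 1" "stereographic s = Finite a" using stereographic_surj_Finite by blast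
    then show ?thesis
      using tendsto_unique[OF sphere_islimpt_hyp_ball lim[OF cd(1)] lim[OF cd(2)]] by blast
  qed
  have indep_a: "\<Lambda> b (horizontal a) = \<Lambda> b (horizontal 0)" for a
  proof -
    \<comment> \<open>The quotient of the two values of \<open>\<Lambda>\<close> is constant in \<open>c\<close> and tends to \<open>1\<close> at the north pole.\<close>
    let ?N = "(0, 0, 1) :: point3" let ?F = "at ?N within hyp_ball"
    have N: "?N \<in> sphere 0 1" by (simp add: norm_Pair)
    have inf: "filterlim G at_infinity ?F" "filterlim E at_infinity ?F"
      using G[unfolded is_ball_to_uhs_def, THEN conjunct2, rule_format, OF N]
        E[unfolded is_ball_to_uhs_def, THEN conjunct2, rule_format, OF N]
      by (simp_all add: tends_to_boundary_def stereographic_def)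
    have "((\<lambda>c. (norm (G c - horizontal a) / norm (G c - horizontal 0))\<^sup>2 *
        (norm (E c - horizontal 0) / norm (E c - horizontal a))\<^sup>2) \<longlongrightarrow> 1\<^sup>2 * 1\<^sup>2) ?F"
      by (intro tendsto_intros dist_ratio_tendsto_1 inf)
    moreover have "eventually (\<lambda>c. (norm (G c - horizontal a) / norm (G c - horizontal 0))\<^sup>2 *
        (norm (E c - horizontal 0) / norm (E c - horizontal a))\<^sup>2 = \<Lambda> b (horizontal a) / \<Lambda> b (horizontal 0)) ?F"
    proof -
      have "eventually (\<lambda>d. d \<in> hyp_ball) ?F"
        by (simp add: eventually_at_filter)
      then show ?thesis
      proof eventually_elim
        case (elim c)
        then show ?case
          unfolding indep_c[OF b elim]
          using ne[OF elim, of a] ne[OF elim, of 0] hG[OF elim] hE[OF elim]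
          by (simp add: \<Lambda>_def power_divide)
      qed
    qed
    ultimately have "((\<lambda>c. \<Lambda> b (horizontal a) / \<Lambda> b (horizontal 0)) \<longlongrightarrow> 1) ?F"
      using Lim_transform_eventually by fastforce
    then have "\<Lambda> b (horizontal a) / \<Lambda> b (horizontal 0) = 1"
      using tendsto_unique[OF sphere_islimpt_hyp_ball[OF N] tendsto_const] by metis
    then show ?thesis using \<Lambda>_pos[OF b, of 0] by simp
  qed
  show ?thesis
  proof (rule point_determined_by_boundary_distances)
    fix a
    show "(G b - horizontal a) \<bullet> (G b - horizontal a) =
      (\<Lambda> b (horizontal 0) * height (G b) / height (E b)) * ((E b - horizontal a) \<bullet> (E b - horizontal a))"
      unfolding indep_a[of a, symmetric]
      using ne[OF b, of a] hG[OF b] hE[OF b] by (simp add: \<Lambda>_def power2_norm_eq_inner[symmetric])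
  qed (use ball_to_uhs_in_upper_half_space b G E in auto)
qed

section \<open>Horospheres in the hyperboloid and their line fields\<close>

lemma det_4:
  fixes A :: "'a::comm_ring_1^4^4"
  shows "det A =
    A$1$1 * (A$2$2 * (A$3$3 * A$4$4 - A$3$4 * A$4$3) - A$2$3 * (A$3$2 * A$4$4 - A$3$4 * A$4$2) + A$2$4 * (A$3$2 * A$4$3 - A$3$3 * A$4$2))
  - A$1$2 * (A$2$1 * (A$3$3 * A$4$4 - A$3$4 * A$4$3) - A$2$3 * (A$3$1 * A$4$4 - A$3$4 * A$4$1) + A$2$4 * (A$3$1 * A$4$3 - A$3$3 * A$4$1))
  + A$1$3 * (A$2$1 * (A$3$2 * A$4$4 - A$3$4 * A$4$2) - A$2$2 * (A$3$1 * A$4$4 - A$3$4 * A$4$1) + A$2$4 * (A$3$1 * A$4$2 - A$3$2 * A$4$1))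
  - A$1$4 * (A$2$1 * (A$3$2 * A$4$3 - A$3$3 * A$4$2) - A$2$2 * (A$3$1 * A$4$3 - A$3$3 * A$4$1) + A$2$3 * (A$3$1 * A$4$2 - A$3$2 * A$4$1))"
proof -
  have f1: "finite {2::4, 3, 4}" "1 \<notin> {2::4, 3, 4}" by auto
  have f2: "finite {3::4, 4}" "2 \<notin> {3::4, 4}" by auto
  have f3: "finite {4::4}" "3 \<notin> {4::4}" by auto
  show ?thesis
    unfolding det_def UNIV_4
    unfolding sum_over_permutations_insert[OF f1]
    unfolding sum_over_permutations_insert[OF f2]
    unfolding sum_over_permutations_insert[OF f3]
    unfolding permutes_sing
    apply (simp add: sign_swap_id permutation_swap_id sign_compose permutation_compose sign_id swap_id_eq)
    apply (simp add: algebra_simps)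
    done
qed


lemma mink_bilinear: "bounded_bilinear mink"
proof -
  have "bilinear mink"
    unfolding bilinear_def by (auto intro!: linearI simp: mink_simps)
  then show ?thesis by (simp add: bilinear_conv_bounded_bilinear)
qed

definition spatial :: "real^4 \<Rightarrow> point3" where
  "spatial x = (x$2, x$3, x$4)"

lemma mink_eq_spatial: "mink x y = x$1 * y$1 - spatial x \<bullet> spatial y"
  by (simp add: mink_def spatial_def inner_prod_def)

text \<open>On the past sheet of the unit hyperboloid all products with future null vectors are
  negative, by the Cauchy-Schwarz inequality for the spatial parts.\<close>

lemma future_of_mink_light_cone:
  assumes "mink x x = 1" "p \<in> light_cone" "mink x p = 1"
  shows "x$1 > 0"
proof (rule ccontr)
  assume "\<not> x$1 > 0"
  then have neg: "x$1 * p$1 \<le> 0"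
    using assms(2) by (simp add: light_cone_def mult_le_0_iff)
  have p1: "p$1 > 0" and pp: "spatial p \<bullet> spatial p = p$1 * p$1"
    using assms(2) by (auto simp: light_cone_def mink_eq_spatial)
  have xx: "spatial x \<bullet> spatial x = x$1 * x$1 - 1" and xp: "spatial x \<bullet> spatial p = x$1 * p$1 - 1"
    using assms by (auto simp: mink_eq_spatial)
  have "(x$1 * p$1 - 1)\<^sup>2 \<le> (x$1 * x$1 - 1) * (p$1 * p$1)"
    using Cauchy_Schwarz_ineq[of "spatial x" "spatial p"] unfolding xx xp pp .
  then have "1 - 2 * (x$1 * p$1) + p$1 * p$1 \<le> 0"
    by (simp add: power2_eq_square algebra_simps)
  then show False using neg p1 zero_le_square[of "p$1"] by linarith
qed

text \<open>Otherwise the Cauchy-Schwarz inequality for the spatial parts of \<open>x\<close> and \<open>q\<close> forces the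
  time component of \<open>x\<close>, and with it \<open>x\<close>, to vanish.\<close>

lemma spacelike_of_orthogonal_hyperboloid:
  assumes "q \<in> hyperboloid" "mink x q = 0" "x \<noteq> 0"
  shows "mink x x < 0"
proof (rule ccontr)
  assume "\<not> mink x x < 0"
  then have le: "spatial x \<bullet> spatial x \<le> x$1 * x$1" by (simp add: mink_eq_spatial)
  have q1: "q$1 > 0" and qq: "spatial q \<bullet> spatial q = q$1 * q$1 - 1" and xq: "spatial x \<bullet> spatial q = x$1 * q$1"
    using assms by (auto simp: hyperboloid_def mink_eq_spatial)
  have "(x$1 * q$1)\<^sup>2 \<le> (spatial x \<bullet> spatial x) * (q$1 * q$1 - 1)"
    using Cauchy_Schwarz_ineq[of "spatial x" "spatial q"] unfolding qq xq .
  also have "\<dots> \<le> (x$1 * x$1) * (q$1 * q$1 - 1)"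
    using le inner_ge_zero[of "spatial q"] unfolding qq by (rule mult_right_mono)
  finally have "x$1 * x$1 \<le> 0" by (simp add: power2_eq_square algebra_simps)
  then have "x$1 = 0" by (metis mult_eq_0_iff not_square_less_zero order.antisym not_less)
  moreover from this le have "spatial x = 0"
    using inner_ge_zero[of "spatial x"] by (metis inner_eq_zero_iff mult_zero_left order.antisym)
  ultimately show False
    using assms(3) by (simp add: vec_eq_iff forall_4 spatial_def zero_prod_def)
qed

text \<open>A horosphere is a paraboloid: a Euclidean plane bent along \<open>p\<close>. The point \<open>q\<close> and the
  tangent vectors at \<open>q\<close> parametrize it.\<close>

lemma phi2_curve:
  assumes "p \<in> light_cone" "q \<in> phi2 p" "mink u q = 0" "mink u p = 0"
  shows "q + u - (mink u u / 2) *\<^sub>R p \<in> phi2 p"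
proof -
  have pp: "mink p p = 0" using assms by (simp add: light_cone_def)
  have q: "mink q q = 1" "mink q p = 1" using assms by (auto simp: phi2_def hyperboloid_def)
  let ?x = "q + u - (mink u u / 2) *\<^sub>R p"
  have "mink ?x ?x = 1" "mink ?x p = 1"
    using assms(3,4) q pp by (simp_all add: mink_simps mink_commute[of q u] mink_commute[of p u] mink_commute[of p q])
  with future_of_mink_light_cone[OF this(1) assms(1) this(2)] show ?thesis
    unfolding phi2_def hyperboloid_def by blast
qed

text \<open>Differentiating the two equations of the horosphere along a curve gives one inclusion; the
  parabolas from \<open>phi2_curve\<close> give the other.\<close>

lemma tangent_space_phi2:
  assumes "p \<in> light_cone" "q \<in> phi2 p"
  shows "tangent_space (phi2 p) q = {u. mink u q = 0 \<and> mink u p = 0}"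
proof (intro subset_antisym subsetI)
  fix u assume "u \<in> tangent_space (phi2 p) q"
  then obtain c where c: "c 0 = q" "\<And>t::real. c t \<in> phi2 p" "(c has_vector_derivative u) (at 0)"
    by (auto simp: tangent_space_def)
  have "((\<lambda>t. mink (c t) p) has_vector_derivative mink u p) (at 0)"
    using bounded_bilinear.has_vector_derivative[OF mink_bilinear c(3) has_vector_derivative_const[of p]]
    by (simp add: mink_def)
  moreover have "(\<lambda>t. mink (c t) p) = (\<lambda>t. 1)" using c(2) by (auto simp: phi2_def)
  ultimately have 1: "mink u p = 0"
    using vector_derivative_unique_at has_vector_derivative_const by metis
  have "((\<lambda>t. mink (c t) (c t)) has_vector_derivative (mink q u + mink u q)) (at 0)"
    using bounded_bilinear.has_vector_derivative[OF mink_bilinear c(3) c(3)] c(1) by simp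
  moreover have "(\<lambda>t. mink (c t) (c t)) = (\<lambda>t. 1)" using c(2) by (auto simp: phi2_def hyperboloid_def)
  ultimately have "mink q u + mink u q = 0"
    using vector_derivative_unique_at has_vector_derivative_const by metis
  with 1 show "u \<in> {u. mink u q = 0 \<and> mink u p = 0}" by (simp add: mink_commute[of q u])
next
  fix u assume "u \<in> {u. mink u q = 0 \<and> mink u p = 0}"
  then have u: "mink u q = 0" "mink u p = 0" by auto
  define c where "c t = q + t *\<^sub>R u - (mink (t *\<^sub>R u) (t *\<^sub>R u) / 2) *\<^sub>R p" for t
  have "c t \<in> phi2 p" for t
    unfolding c_def by (rule phi2_curve[OF assms]) (simp_all add: mink_simps u)
  moreover have "(c has_vector_derivative u) (at 0)"
    unfolding c_def[abs_def] mink_simps by (auto intro!: derivative_eq_intros)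
  moreover have "c 0 = q" by (simp add: c_def mink_zero)
  ultimately show "u \<in> tangent_space (phi2 p) q" by (auto simp: tangent_space_def)
qed

text \<open>In the half-plane of the flag, the vectors \<open>a p + b v\<close> orthogonal to \<open>q\<close> are those with \<open>a
  = - b \<langle>v, q\<rangle>\<close>, as \<open>\<langle>p, q\<rangle> = 1\<close>.\<close>

lemma Phi2_flag_of:
  assumes p: "p \<in> light_cone" and v: "mink v p = 0"
  shows "Phi2 (flag_of p v) = (phi2 p, \<lambda>q. if q \<in> phi2 p then open_ray (v - mink v q *\<^sub>R p) else {})"
proof -
  have pp: "mink p p = 0" using p by (simp add: light_cone_def)
  have "tangent_space (phi2 p) q \<inter> span {p, v} \<inter> half_plane p v = open_ray (v - mink v q *\<^sub>R p)"
    if q: "q \<in> phi2 p" for q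
  proof (intro subset_antisym subsetI)
    have pq: "mink p q = 1" using q by (simp add: phi2_def mink_commute)
    {
      fix u assume "u \<in> tangent_space (phi2 p) q \<inter> span {p, v} \<inter> half_plane p v"
      then obtain a b where u: "u = a *\<^sub>R p + b *\<^sub>R v" "b > 0" "mink u q = 0"
        unfolding tangent_space_phi2[OF p q] by (auto simp: half_plane_def)
      then have "a = - b * mink v q" by (simp add: mink_simps pq)
      then have "u = b *\<^sub>R (v - mink v q *\<^sub>R p)" using u by (simp add: algebra_simps)
      then show "u \<in> open_ray (v - mink v q *\<^sub>R p)" using u by (auto simp: open_ray_def)
    next
      fix u assume "u \<in> open_ray (v - mink v q *\<^sub>R p)"
      then obtain b where b: "b > 0" "u = b *\<^sub>R (v - mink v q *\<^sub>R p)" by (auto simp: open_ray_def)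
      then have u: "u = (- b * mink v q) *\<^sub>R p + b *\<^sub>R v" by (simp add: algebra_simps)
      have "u \<in> half_plane p v" using u b unfolding half_plane_def by blast
      moreover have "u \<in> span {p, v}"
        unfolding u by (intro span_add span_scale span_base) auto
      moreover have "mink u q = 0" "mink u p = 0" by (simp_all add: b mink_simps pq pp v)
      ultimately show "u \<in> tangent_space (phi2 p) q \<inter> span {p, v} \<inter> half_plane p v"
        unfolding tangent_space_phi2[OF p q] by auto
    }
  qed
  moreover have "tangent_space (phi2 p) q = {}" if "q \<notin> phi2 p" for q
    using that by (auto simp: tangent_space_def)
  ultimately show ?thesis
    by (auto simp: Phi2_def flag_of_def fun_eq_iff simp del: Int_iff)
qed

text \<open>A basis of Minkowski space adapted to a horosphere and one of its points: \<open>e\<close> and \<open>f\<close> are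
  an orthonormal basis of the tangent plane at \<open>q\<close>, and they represent an orthonormal basis of
  \<open>p\<^sup>\<bottom> / \<real>p\<close>.\<close>

locale horosphere_frame =
  fixes p e f q :: "real^4"
  assumes p: "p \<in> light_cone" and q: "q \<in> phi2 p"
    and e: "mink e p = 0" "mink e q = 0" "mink e e = -1"
    and f: "mink f p = 0" "mink f q = 0" "mink f f = -1"
    and ef: "mink e f = 0"
begin

lemma mink_frame:
  "mink p p = 0" "mink q q = 1" "mink p q = 1" "mink q p = 1" "mink p e = 0" "mink q e = 0"
  "mink p f = 0" "mink q f = 0" "mink f e = 0"
  using p q e f ef mink_commute by (auto simp: light_cone_def phi2_def hyperboloid_def)

lemmas frame_simps = mink_frame e f ef

definition frame :: "real^4^4" where "frame = vector [p, e, f, q]"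

text \<open>The rows of the frame with lowered indices, so that multiplication by the coframe computes
  Minkowski products with the basis vectors.\<close>

definition coframe :: "real^4^4" where
  "coframe = (\<chi> i. vector [frame$i$1, - frame$i$2, - frame$i$3, - frame$i$4])"

text \<open>The Gram matrix of the basis is invertible.\<close>

lemma det_frame: "det frame \<noteq> 0" "det coframe \<noteq> 0"
proof -
  have "(frame ** transpose coframe)$i$j = mink (frame$i) (frame$j)" for i j
    by (simp add: matrix_matrix_mult_def transpose_def coframe_def mink_def sum_4)
  then have "det (frame ** transpose coframe) = -1"
    by (simp add: det_4 frame_def frame_simps)
  then have "det frame * det coframe = -1" by (simp add: det_mul)
  then show "det frame \<noteq> 0" "det coframe \<noteq> 0" by auto
qed

lemma eq_zeroI:
  assumes "mink x p = 0" "mink x e = 0" "mink x f = 0" "mink x q = 0"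
  shows "x = 0"
proof -
  have "(coframe *v x)$i = mink x (frame$i)" for i
    by (simp add: matrix_vector_mult_def coframe_def mink_def sum_4 mult.commute)
  then have "coframe *v x = 0"
    using assms by (simp add: vec_eq_iff forall_4 frame_def)
  moreover have "invertible coframe" using det_frame invertible_det_nz by blast
  ultimately show ?thesis
    by (metis invertible_def matrix_left_invertible_ker)
qed

lemma expansion: "x = mink x q *\<^sub>R p + mink x p *\<^sub>R (q - p) - mink x e *\<^sub>R e - mink x f *\<^sub>R f"
proof -
  have "x - (mink x q *\<^sub>R p + mink x p *\<^sub>R (q - p) - mink x e *\<^sub>R e - mink x f *\<^sub>R f) = 0"
    by (rule eq_zeroI) (simp_all add: mink_simps frame_simps)
  then show ?thesis by simp
qed

text \<open>On a horosphere the tangential coordinates determine the coordinate along \<open>p\<close>.\<close>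

lemma phi2_eqI:
  assumes "x \<in> phi2 p" "y \<in> phi2 p" "mink x e = mink y e" "mink x f = mink y f"
  shows "x = y"
proof -
  define a b where "a = mink x q" and "b = mink y q"
  define w where "w = (q - p) - mink x e *\<^sub>R e - mink x f *\<^sub>R f"
  have x: "x = a *\<^sub>R p + w"
    using expansion[of x] assms by (simp add: phi2_def a_def w_def algebra_simps)
  have "y = b *\<^sub>R p + w"
    using expansion[of y] assms by (simp add: phi2_def b_def w_def algebra_simps)
  with x have y: "y = x + (b - a) *\<^sub>R p" by (simp add: algebra_simps)
  have "mink y y = mink x x + 2 * (b - a) * mink x p"
    unfolding y by (simp add: mink_simps frame_simps mink_commute[of p x])
  then have "a = b" using assms by (simp add: phi2_def hyperboloid_def)
  with y show ?thesis by simp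
qed

text \<open>The products with \<open>p\<close> and with its image are both \<open>1\<close> on the horosphere, and the
  horosphere spans the whole space.\<close>

lemma isometry_fixes_centre:
  assumes A: "\<And>x y. mink (A *v x) (A *v y) = mink x y" and S: "(\<lambda>x. A *v x) ` phi2 p = phi2 p"
  shows "A *v p = p"
proof -
  define d where "d = A *v p - p"
  have d: "mink y d = 0" if y: "y \<in> phi2 p" for y
  proof -
    obtain x where x: "x \<in> phi2 p" "y = A *v x" using y S by blast
    then have "mink y (A *v p) = 1" using A by (simp add: phi2_def)
    moreover have "mink y p = 1" using y by (simp add: phi2_def)
    ultimately show ?thesis by (simp add: d_def mink_simps)
  qed
  have par: "mink x d = 0 \<and> mink p d = 0" if x: "mink x p = 0" "mink x q = 0" "mink x x = -1" for x
    using d[OF q] d[OF phi2_curve[OF p q x(2,1)]] d[OF phi2_curve[OF p q, of "- x"]] x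
    by (simp add: mink_simps)
  have "d = 0"
    by (rule eq_zeroI) (use par[of e] par[of f] d[OF q] frame_simps in \<open>auto simp: mink_commute[of d]\<close>)
  then show ?thesis by (simp add: d_def)
qed

text \<open>With respect to the basis \<open>p, e, f, q\<close> the matrix of the isometry is block triangular,
  with diagonal entries \<open>1\<close> for \<open>p\<close> and \<open>q\<close>; thus its determinant is that of the orthogonal
  block for \<open>e\<close> and \<open>f\<close>. Determinant one excludes reflections.\<close>

lemma rotation_coefficients:
  assumes A: "\<And>x y. mink (A *v x) (A *v y) = mink x y" "det A = 1" "A *v p = p"
  defines "\<alpha> \<equiv> - mink (A *v e) e" and "\<beta> \<equiv> - mink (A *v e) f"
  shows "\<alpha>\<^sup>2 + \<beta>\<^sup>2 = 1" "mink (A *v f) e = \<beta>" "mink (A *v f) f = - \<alpha>"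
    "A *v e = \<alpha> *\<^sub>R e + \<beta> *\<^sub>R f + mink (A *v e) q *\<^sub>R p"
    "A *v f = - \<beta> *\<^sub>R e + \<alpha> *\<^sub>R f + mink (A *v f) q *\<^sub>R p"
proof -
  define \<gamma> \<delta> where "\<gamma> = - mink (A *v f) e" and "\<delta> = - mink (A *v f) f"
  define \<rho> \<mu> where "\<rho> = mink (A *v e) q" and "\<mu> = mink (A *v f) q"
  have "mink (A *v x) p = mink x p" for x using A(1)[of x p] A(3) by simp
  then have Ap: "mink (A *v e) p = 0" "mink (A *v f) p = 0" "mink (A *v q) p = 1"
    by (simp_all add: frame_simps)
  have Ae: "A *v e = \<alpha> *\<^sub>R e + \<beta> *\<^sub>R f + \<rho> *\<^sub>R p"
    using expansion[of "A *v e"] by (simp add: Ap \<alpha>_def \<beta>_def \<rho>_def algebra_simps)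
  have Af: "A *v f = \<gamma> *\<^sub>R e + \<delta> *\<^sub>R f + \<mu> *\<^sub>R p"
    using expansion[of "A *v f"] by (simp add: Ap \<gamma>_def \<delta>_def \<mu>_def algebra_simps)
  have n: "\<alpha> * \<alpha> + \<beta> * \<beta> = 1" using A(1)[of e e] unfolding Ae by (simp add: mink_simps frame_simps)
  have o: "\<alpha> * \<gamma> + \<beta> * \<delta> = 0" using A(1)[of e f] unfolding Ae Af by (simp add: mink_simps frame_simps algebra_simps)
  define a b c where "a = mink (A *v q) q - 1" and "b = - mink (A *v q) e" and "c = - mink (A *v q) f"
  define C :: "real^4^4" where "C = vector [vector [1, 0, 0, 0], vector [\<rho>, \<alpha>, \<beta>, 0],
    vector [\<mu>, \<gamma>, \<delta>, 0], vector [a, b, c, 1]]"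
  have Aq: "A *v q = a *\<^sub>R p + b *\<^sub>R e + c *\<^sub>R f + q"
    unfolding a_def b_def c_def using expansion[of "A *v q"] by (simp add: Ap algebra_simps)
  have row: "(frame ** transpose A)$i = A *v (frame$i)" for i
    by (simp add: vec_eq_iff matrix_matrix_mult_def matrix_vector_mult_def transpose_def mult.commute)
  have row': "(C ** frame)$i = (C$i$1) *\<^sub>R p + (C$i$2) *\<^sub>R e + (C$i$3) *\<^sub>R f + (C$i$4) *\<^sub>R q" for i
    by (simp add: vec_eq_iff matrix_matrix_mult_def sum_4 frame_def)
  have "(frame ** transpose A)$i = (C ** frame)$i" for i
  proof -
    have "i = 1 \<or> i = 2 \<or> i = 3 \<or> i = 4" by (rule exhaust_4)
    then show ?thesis
      unfolding row row'
      by (elim disjE) (simp_all add: frame_def C_def A(3) Ae Af Aq)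
  qed
  then have "frame ** transpose A = C ** frame" by (simp add: vec_eq_iff)
  then have "det frame * det A = det C * det frame" by (metis det_mul det_transpose)
  then have "det C = 1" using det_frame A(2) by simp
  moreover have "det C = \<alpha> * \<delta> - \<beta> * \<gamma>" by (simp add: det_4 C_def)
  ultimately have D: "\<alpha> * \<delta> - \<beta> * \<gamma> = 1" by simp
  have \<delta>: "\<delta> = \<alpha>" and \<gamma>: "\<gamma> = - \<beta>" using n o D by algebra+
  show "\<alpha>\<^sup>2 + \<beta>\<^sup>2 = 1" using n by (simp add: power2_eq_square)
  show "mink (A *v f) e = \<beta>" "mink (A *v f) f = - \<alpha>"
    using \<gamma> \<delta> unfolding \<gamma>_def \<delta>_def by linarith+
  show "A *v e = \<alpha> *\<^sub>R e + \<beta> *\<^sub>R f + mink (A *v e) q *\<^sub>R p"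
    using Ae unfolding \<rho>_def .
  show "A *v f = - \<beta> *\<^sub>R e + \<alpha> *\<^sub>R f + mink (A *v f) q *\<^sub>R p"
    using Af unfolding \<gamma> \<delta> \<mu>_def .
qed

text \<open>On the Euclidean plane with coordinates \<open>s, t\<close> along \<open>e, f\<close>, the isometry acts by the
  rotation \<open>R\<close> with entries \<open>\<alpha>\<close> and \<open>\<beta>\<close> followed by the translation by \<open>(a, b)\<close>. A rotation \<open>R \<noteq>
  1\<close> would leave \<open>1 - R\<close> invertible, with determinant \<open>m = 2 - 2 \<alpha>\<close>, and so would produce a
  fixed point.\<close>

lemma fixed_point_free_isometry_translates:
  assumes A: "\<And>x y. mink (A *v x) (A *v y) = mink x y" "det A = 1"
    and S: "(\<lambda>x. A *v x) ` phi2 p = phi2 p" and free: "\<And>x. x \<in> phi2 p \<Longrightarrow> A *v x \<noteq> x"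
  shows "A *v e = e + mink (A *v e) q *\<^sub>R p"
proof -
  have Ap: "A *v p = p" by (rule isometry_fixes_centre[OF A(1) S])
  define \<alpha> \<beta> where "\<alpha> = - mink (A *v e) e" and "\<beta> = - mink (A *v e) f"
  note R = rotation_coefficients[OF A Ap, folded \<alpha>_def \<beta>_def]
  define a b where "a = - mink (A *v q) e" and "b = - mink (A *v q) f"
  have "\<alpha> = 1"
  proof (rule ccontr)
    assume ne: "\<alpha> \<noteq> 1"
    define m where "m = 2 - 2 * \<alpha>"
    have m: "m \<noteq> 0" "(1 - \<alpha>) * (1 - \<alpha>) + \<beta> * \<beta> = m"
      using ne R(1) by (simp_all add: m_def power2_eq_square algebra_simps)
    \<comment> \<open>The solution \<open>(s, t)\<close> of \<open>(1 - R) (s, t) = (a, b)\<close> by Cramer's rule.\<close>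
    define s t where "s = ((1 - \<alpha>) * a - \<beta> * b) / m" and "t = (\<beta> * a + (1 - \<alpha>) * b) / m"
    have s: "a + \<alpha> * s - \<beta> * t = s"
    proof -
      have "m * ((1 - \<alpha>) * s + \<beta> * t) = ((1 - \<alpha>) * (1 - \<alpha>) + \<beta> * \<beta>) * a"
        using m(1) by (simp add: s_def t_def field_simps)
      then have "(1 - \<alpha>) * s + \<beta> * t = a" using m by simp
      then show ?thesis by (simp add: algebra_simps)
    qed
    have t: "b + \<beta> * s + \<alpha> * t = t"
    proof -
      have "m * ((1 - \<alpha>) * t - \<beta> * s) = ((1 - \<alpha>) * (1 - \<alpha>) + \<beta> * \<beta>) * b"
        using m(1) by (simp add: s_def t_def field_simps)
      then have "(1 - \<alpha>) * t - \<beta> * s = b" using m by simp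
      then show ?thesis by (simp add: algebra_simps)
    qed
    define u where "u = s *\<^sub>R e + t *\<^sub>R f"
    define x where "x = q + u - (mink u u / 2) *\<^sub>R p"
    have x: "x \<in> phi2 p"
      unfolding x_def by (rule phi2_curve[OF p q]) (simp_all add: u_def mink_simps frame_simps)
    have Ax: "A *v x = A *v q + s *\<^sub>R (A *v e) + t *\<^sub>R (A *v f) - (mink u u / 2) *\<^sub>R p"
      unfolding x_def u_def
      by (simp add: matrix_vector_right_distrib matrix_vector_mult_diff_distrib matrix_vector_mult_scaleR Ap)
    have "A *v x = x"
    proof (rule phi2_eqI[OF _ x])
      show "A *v x \<in> phi2 p" using S x by blast
      have "mink (A *v x) e = - (a + \<alpha> * s - \<beta> * t)"
        using R(2) by (simp add: Ax mink_simps frame_simps a_def \<alpha>_def)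
      then show "mink (A *v x) e = mink x e"
        unfolding s by (simp add: x_def u_def mink_simps frame_simps)
      have "mink (A *v x) f = - (b + \<beta> * s + \<alpha> * t)"
        using R(3) by (simp add: Ax mink_simps frame_simps b_def \<beta>_def)
      then show "mink (A *v x) f = mink x f"
        unfolding t by (simp add: x_def u_def mink_simps frame_simps)
    qed
    with free x show False by blast
  qed
  then show ?thesis using R(1,4) by simp
qed

end

text \<open>A vector orthogonal to \<open>p\<close>, \<open>e\<close> and \<open>q\<close> exists by counting dimensions; it is spacelike
  because \<open>q\<close> is timelike.\<close>

lemma horosphere_frame_exists:
  assumes p: "p \<in> light_cone" and q: "q \<in> phi2 p"
    and e: "mink e p = 0" "mink e q = 0" "mink e e = -1"
  shows "\<exists>f. horosphere_frame p e f q"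
proof -
  \<comment> \<open>Lowering the index turns Minkowski orthogonality into Euclidean orthogonality.\<close>
  define J :: "real^4 \<Rightarrow> real^4" where "J x = vector [x$1, - x$2, - x$3, - x$4]" for x
  have J: "orthogonal x (J y) \<longleftrightarrow> mink x y = 0" for x y
    by (simp add: J_def orthogonal_def inner_vec_def sum_4 mink_def)
  have "dim {J p, J e, J q} \<le> card {J p, J e, J q}" by (rule dim_le_card') simp
  also have "\<dots> \<le> 3" by (simp add: card_insert_if)
  finally have "dim {J p, J e, J q} < DIM(real^4)" by simp
  then obtain x where x: "x \<noteq> 0" "\<And>y. y \<in> span {J p, J e, J q} \<Longrightarrow> orthogonal x y"
    using orthogonal_to_subspace_exists by blast
  have "mink x p = 0" "mink x e = 0" "mink x q = 0"
    using x(2) J by (auto intro: span_base)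
  moreover have "mink x x < 0"
    using spacelike_of_orthogonal_hyperboloid[OF _ \<open>mink x q = 0\<close> x(1)] q by (simp add: phi2_def)
  moreover define r where "r = sqrt (- mink x x)"
  ultimately have "horosphere_frame p e ((1 / r) *\<^sub>R x) q"
    using p q e by unfold_locales (simp_all add: mink_simps mink_commute[of e x])
  then show ?thesis by blast
qed

text \<open>The direction \<open>u q = v - \<langle>v, q\<rangle> p\<close> of the line field at \<open>q\<close> is the only vector in \<open>v + \<real>p\<close>
  orthogonal to \<open>q\<close>. A parabolic isometry that preserves the horosphere also preserves \<open>v + \<real>p\<close>,
  and therefore maps \<open>u q\<close> to the direction at the image of \<open>q\<close>.\<close>

lemma decorated_horosphere_Phi2:
  assumes p: "p \<in> light_cone" and v: "mink v p = 0" "mink v v < 0"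
  shows "decorated_horosphere (Phi2 (flag_of p v))"
proof -
  have pp: "mink p p = 0" using p by (simp add: light_cone_def)
  define u where "u q = v - mink v q *\<^sub>R p" for q
  have u: "mink (u q) q = 0" "mink (u q) p = 0" "mink (u q) (u q) = mink v v" if "q \<in> phi2 p" for q
    using that v pp by (simp_all add: u_def mink_simps phi2_def mink_commute[of p q] mink_commute[of p v])
  have "\<exists>v\<in>tangent_space (phi2 p) q. v \<noteq> 0 \<and> open_ray (u q) = open_ray v" if q: "q \<in> phi2 p" for q
  proof -
    have "u q \<noteq> 0" using u(3)[OF q] v(2) by (auto simp: mink_def)
    then show ?thesis using u[OF q] by (auto simp: tangent_space_phi2[OF p q])
  qed
  moreover have "open_ray (u (A *v q)) = (\<lambda>v. A *v v) ` open_ray (u q)"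
    if A: "parabolic_isometry A" "(\<lambda>x. A *v x) ` phi2 p = phi2 p" and q: "q \<in> phi2 p" for A q
  proof -
    have iso: "\<And>x y. mink (A *v x) (A *v y) = mink x y" and det: "det A = 1"
      and free: "\<And>x. x \<in> phi2 p \<Longrightarrow> A *v x \<noteq> x"
      using A by (auto simp: parabolic_isometry_def oriented_isometry_def phi2_def)
    define r where "r = sqrt (- mink v v)"
    have r: "r > 0" "r * r = - mink v v" using v(2) by (auto simp: r_def)
    define e where "e = (1 / r) *\<^sub>R u q"
    have ue: "u q = r *\<^sub>R e" using r by (simp add: e_def)
    have "mink e e = -1" using r u(3)[OF q] v(2) by (simp add: e_def mink_simps field_simps)
    then obtain f where "horosphere_frame p e f q"
      using horosphere_frame_exists[OF p q, of e] u[OF q] by (auto simp: e_def mink_simps)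
    then interpret horosphere_frame p e f q .
    define c where "c = r * mink (A *v e) q"
    have "A *v u q = r *\<^sub>R (A *v e)" by (simp add: ue matrix_vector_mult_scaleR)
    also have "A *v e = e + mink (A *v e) q *\<^sub>R p"
      by (rule fixed_point_free_isometry_translates[OF iso det A(2) free])
    finally have Au: "A *v u q = u q + c *\<^sub>R p" by (simp add: ue c_def algebra_simps)
    have Aq: "A *v q \<in> phi2 p" using A(2) q by blast
    have "mink (u q + c *\<^sub>R p) (A *v q) = 0" using iso u(1)[OF q] unfolding Au[symmetric] by simp
    then have "mink v (A *v q) = mink v q - c"
      using Aq by (simp add: u_def mink_simps phi2_def mink_commute[of p "A *v q"])
    then have "u (A *v q) = A *v u q" by (simp add: Au u_def[of "A *v q"]) (simp add: u_def algebra_simps)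
    then show ?thesis
      by (auto simp: open_ray_def image_def matrix_vector_mult_scaleR) 
  qed
  ultimately show ?thesis
    unfolding decorated_horosphere_def Phi2_flag_of[OF p v(1)] u_def[symmetric]
    using p by auto
qed

section \<open>Transport to upper half space\<close>

text \<open>With \<open>s = T - Z\<close> and \<open>t = 1 + T\<close>, the squared distance of the point of the ball from the
  centre of inversion is \<open>2 s / t\<close>.\<close>

lemma explicit_ball_of_hyperboloid:
  assumes "x \<in> hyperboloid"
  shows "explicit_ball_to_uhs (ball_of_hyperboloid x) = uhs_of_hyperboloid x"
proof -
  define s t where "s = x$1 - x$4" and "t = 1 + x$1"
  have s: "s > 0" using hyperboloid_pos[OF assms] by (simp add: s_def)
  have t: "t > 0" using assms by (simp add: t_def hyperboloid_def)
  let ?u = "ball_of_hyperboloid x - (0, 0, 1)"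
  have u: "?u = (x$2 / t, x$3 / t, - ((s + 1) / t))"
    using t by (simp add: ball_of_hyperboloid_def t_def s_def field_simps)
  have "x$1 * x$1 - x$2 * x$2 - x$3 * x$3 - x$4 * x$4 = 1"
    using assms by (simp add: hyperboloid_def mink_def)
  then have e: "x$2 * x$2 + x$3 * x$3 + (s + 1) * (s + 1) = 2 * s * t"
    by (simp add: s_def t_def algebra_simps)
  have "?u \<bullet> ?u = (x$2 * x$2 + x$3 * x$3 + (s + 1) * (s + 1)) / (t * t)"
    using t by (simp add: u inner_prod_def field_simps)
  also have "\<dots> = 2 * s / t" unfolding e using t by simp
  finally have i: "inversion ?u = (t / s) *\<^sub>R ?u" using s t by (simp add: inversion_def)
  show ?thesis
    unfolding explicit_ball_to_uhs_def i unfolding u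
    using s t by (simp add: reflect_z_def uhs_of_hyperboloid_def s_def[symmetric] field_simps)
qed

lemma ball_of_hyperboloid_in:
  assumes "x \<in> hyperboloid"
  shows "ball_of_hyperboloid x \<in> hyp_ball"
proof -
  have x: "x$1 > 0" "spatial x \<bullet> spatial x = (x$1)\<^sup>2 - 1"
    using assms by (auto simp: hyperboloid_def mink_eq_spatial power2_eq_square)
  have b: "ball_of_hyperboloid x = (1 / (1 + x$1)) *\<^sub>R spatial x"
    by (simp add: ball_of_hyperboloid_def spatial_def)
  have "ball_of_hyperboloid x \<bullet> ball_of_hyperboloid x = ((x$1)\<^sup>2 - 1) / (1 + x$1)\<^sup>2"
    by (simp add: b x(2) power2_eq_square)
  also have "\<dots> < 1"
  proof -
    have "(x$1)\<^sup>2 - 1 < (1 + x$1)\<^sup>2" using x(1) by (simp add: power2_eq_square algebra_simps)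
    then show ?thesis using x(1) by simp
  qed
  finally show ?thesis by (simp add: hyp_ball_def norm_eq_sqrt_inner)
qed

lemma ball_to_uhs_of_hyperboloid:
  assumes "is_ball_to_uhs G" "x \<in> hyperboloid"
  shows "(G \<circ> ball_of_hyperboloid) x = uhs_of_hyperboloid x"
  using ball_to_uhs_unique[OF assms(1) ball_to_uhs_exists ball_of_hyperboloid_in[OF assms(2)]]
    explicit_ball_of_hyperboloid[OF assms(2)] by simp

text \<open>The left side is the derivative of a map on the ambient space, of which only the values on
  the hyperboloid are related to \<open>uhs_of_hyperboloid\<close>. On tangent vectors the derivatives agree,
  since both can be computed along a curve in \<open>S\<close>.\<close>

lemma frechet_derivative_ball_to_uhs:
  assumes G: "is_ball_to_uhs G" and x: "x \<in> S" "S \<subseteq> hyperboloid" and v: "v \<in> tangent_space S x"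
  shows "frechet_derivative (G \<circ> ball_of_hyperboloid) (at x) v = D_uhs x v"
    and "linear (frechet_derivative (G \<circ> ball_of_hyperboloid) (at x))"
proof -
  let ?f = "G \<circ> ball_of_hyperboloid"
  have xH: "x \<in> hyperboloid" using x by blast
  have "1 + x$1 \<noteq> 0" using xH by (simp add: hyperboloid_def)
  then have "(\<lambda>y. 1 / (1 + y$1)) differentiable (at x)"
    by (intro derivative_intros bounded_linear_imp_differentiable bounded_linear_vec_nth) auto
  moreover have "(\<lambda>y. (y$2, y$3, y$4)) differentiable (at x)"
    by (intro bounded_linear_imp_differentiable bounded_linear_Pair bounded_linear_vec_nth)
  ultimately have "ball_of_hyperboloid differentiable (at x)"
    unfolding ball_of_hyperboloid_def[abs_def] by (rule differentiable_scaleR)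
  moreover have "G differentiable (at (ball_of_hyperboloid x))"
    using G ball_of_hyperboloid_in[OF xH]
    unfolding is_ball_to_uhs_def riemannian_isometry_def differentiable_def by blast
  ultimately have "?f differentiable (at x)" by (rule differentiable_chain_at)
  then have f: "(?f has_derivative frechet_derivative ?f (at x)) (at x)"
    by (simp add: frechet_derivative_works)
  then show "linear (frechet_derivative ?f (at x))" by (rule has_derivative_linear)
  obtain c where c: "c 0 = x" "\<And>t::real. c t \<in> S" "(c has_vector_derivative v) (at 0)"
    using v by (auto simp: tangent_space_def)
  have "((?f \<circ> c) has_vector_derivative frechet_derivative ?f (at x) v) (at 0)"
    using vector_derivative_diff_chain_within[OF has_vector_derivative_at_within[OF c(3)], of ?f "frechet_derivative ?f (at x)" UNIV]
      has_derivative_at_withinI[OF f] c(1) by simp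
  moreover have "?f \<circ> c = uhs_of_hyperboloid \<circ> c"
    using ball_to_uhs_of_hyperboloid[OF G] c(2) x(2) by (auto simp: fun_eq_iff)
  moreover have W: "(uhs_of_hyperboloid has_derivative D_uhs x) (at x)"
    using has_derivative_uhs_of_hyperboloid hyperboloid_pos[OF xH] by force
  have "((uhs_of_hyperboloid \<circ> c) has_vector_derivative D_uhs x v) (at 0)"
    using vector_derivative_diff_chain_within[OF has_vector_derivative_at_within[OF c(3)], of uhs_of_hyperboloid "D_uhs x" UNIV]
      has_derivative_at_withinI[OF W] c(1) by simp
  ultimately show "frechet_derivative ?f (at x) v = D_uhs x v"
    using vector_derivative_unique_at by metis
qed

lemma horizontal_of_real_mult: "horizontal (of_real r * w) = r *\<^sub>R horizontal w"
  by (simp add: horizontal_def)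

lemma open_ray_eq_image: "open_ray v = (\<lambda>t. t *\<^sub>R v) ` {0<..}"
  by (auto simp: open_ray_def)

lemma image_open_ray:
  assumes "linear f"
  shows "f ` open_ray v = open_ray (f v)"
  by (simp add: open_ray_eq_image image_image linear_cmul[OF assms])

text \<open>The model change is injective on the hyperboloid, so the union in the definition of the
  push-forward has a single term.\<close>

lemma to_uhs_Phi2:
  assumes G: "is_ball_to_uhs G" and p: "p \<in> light_cone" and v: "mink v p = 0"
  shows "fst (to_uhs G (Phi2 (flag_of p v))) = {y. height y > 0 \<and> mink (hyperboloid_of_uhs y) p = 1}"
    and "\<lbrakk>height y > 0; mink (hyperboloid_of_uhs y) p = 1\<rbrakk> \<Longrightarrow>
      snd (to_uhs G (Phi2 (flag_of p v))) y =
        open_ray (D_uhs (hyperboloid_of_uhs y) (v - mink v (hyperboloid_of_uhs y) *\<^sub>R p))"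
proof -
  let ?f = "G \<circ> ball_of_hyperboloid"
  have pp: "mink p p = 0" using p by (simp add: light_cone_def)
  have S: "phi2 p \<subseteq> hyperboloid" by (auto simp: phi2_def)
  have f: "?f q = uhs_of_hyperboloid q" if "q \<in> phi2 p" for q
    using ball_to_uhs_of_hyperboloid[OF G] that S by blast
  have mem: "hyperboloid_of_uhs y \<in> phi2 p" if "height y > 0" "mink (hyperboloid_of_uhs y) p = 1" for y
    using that hyperboloid_of_uhs_in by (simp add: phi2_def)
  have "?f ` phi2 p = uhs_of_hyperboloid ` phi2 p" using f by (rule image_cong[OF refl])
  also have "\<dots> = {y. height y > 0 \<and> mink (hyperboloid_of_uhs y) p = 1}"
  proof (intro subset_antisym subsetI)
    fix y assume "y \<in> uhs_of_hyperboloid ` phi2 p"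
    then obtain q where q: "q \<in> phi2 p" "y = uhs_of_hyperboloid q" by blast
    then have "q \<in> hyperboloid" using S by blast
    then show "y \<in> {y. height y > 0 \<and> mink (hyperboloid_of_uhs y) p = 1}"
      using q hyperboloid_pos[of q]
      by (simp add: height_uhs_of_hyperboloid hyperboloid_of_uhs_of_hyperboloid phi2_def)
  next
    fix y assume "y \<in> {y. height y > 0 \<and> mink (hyperboloid_of_uhs y) p = 1}"
    then show "y \<in> uhs_of_hyperboloid ` phi2 p"
      using mem[of y] uhs_of_hyperboloid_of_uhs[of y] by (intro image_eqI[of _ _ "hyperboloid_of_uhs y"]) auto
  qed
  finally show "fst (to_uhs G (Phi2 (flag_of p v))) = {y. height y > 0 \<and> mink (hyperboloid_of_uhs y) p = 1}"
    by (simp add: to_uhs_def push_forward_def Phi2_flag_of[OF p v])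
  assume y: "height y > 0" "mink (hyperboloid_of_uhs y) p = 1"
  let ?q = "hyperboloid_of_uhs y"
  let ?u = "v - mink v ?q *\<^sub>R p"
  have "{q \<in> phi2 p. ?f q = y} = {?q}"
    using mem[OF y] f uhs_of_hyperboloid_of_uhs[OF y(1)] hyperboloid_of_uhs_of_hyperboloid S by auto
  moreover have "?u \<in> tangent_space (phi2 p) ?q"
    unfolding tangent_space_phi2[OF p mem[OF y]] using v y pp by (simp add: mink_simps mink_commute[of p ?q])
  from frechet_derivative_ball_to_uhs[OF G mem[OF y] S this]
  have "frechet_derivative ?f (at ?q) ` open_ray ?u = open_ray (D_uhs ?q ?u)"
    by (simp add: image_open_ray)
  ultimately show "snd (to_uhs G (Phi2 (flag_of p v))) y = open_ray (D_uhs ?q ?u)"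
    using mem[OF y] by (simp add: to_uhs_def push_forward_def Phi2_flag_of[OF p v])
qed


section \<open>Horospheres in upper half space\<close>

lemma D_uhs_horizontal:
  assumes "u$1 = u$4"
  shows "D_uhs x u = (1 / (x$1 - x$4)) *\<^sub>R horizontal (Complex (u$2) (u$3))"
  using assms by (simp add: D_uhs_def Let_def horizontal_def)

lemma open_ray_scaleR: "r > 0 \<Longrightarrow> open_ray (r *\<^sub>R v) = open_ray v"
proof (intro subset_antisym subsetI)
  assume r: "r > 0"
  fix x assume "x \<in> open_ray (r *\<^sub>R v)"
  then obtain t where "t > 0" "x = (t * r) *\<^sub>R v" by (auto simp: open_ray_def)
  then show "x \<in> open_ray v" using r unfolding open_ray_def by (metis (mono_tags, lifting) mem_Collect_eq mult_pos_pos)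
next
  assume r: "r > 0"
  fix x assume "x \<in> open_ray v"
  then obtain t where "t > 0" "x = t *\<^sub>R v" by (auto simp: open_ray_def)
  then have "t / r > 0" "x = (t / r) *\<^sub>R (r *\<^sub>R v)" using r by auto
  then show "x \<in> open_ray (r *\<^sub>R v)" unfolding open_ray_def by blast
qed

lemma at_boundary_plane: "at_boundary {y. height y = h} = {Infinity}" if "h > 0"
proof -
  have "closed {y. height y = h}"
    unfolding height_def by (intro closed_Collect_eq continuous_intros)
  then have "horizontal c \<notin> closure {y. height y = h}" for c
    using that by (simp add: height_def horizontal_def)
  moreover have "\<not> bounded {y. height y = h}"
  proof
    assume "bounded {y. height y = h}"
    then obtain B where B: "\<And>y. height y = h \<Longrightarrow> norm y \<le> B" by (auto simp: bounded_iff)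
    have "norm (\<bar>B\<bar> + 1, 0 :: real, h) \<ge> \<bar>B\<bar> + 1"
      using norm_fst_le[of "\<bar>B\<bar> + 1" "(0 :: real, h)"] by simp
    then show False using B[of "(\<bar>B\<bar> + 1, 0, h)"] by (simp add: height_def)
  qed
  ultimately show ?thesis
    unfolding at_boundary_def by (auto split: boundary_point.splits)
qed

text \<open>The sphere of diameter \<open>d\<close> that touches the boundary plane at \<open>c\<close>, without the point of
  tangency.\<close>

definition tangent_sphere :: "complex \<Rightarrow> real \<Rightarrow> point3 set" where
  "tangent_sphere c d =
     {(x, y, z). z > 0 \<and> (x - Re c)\<^sup>2 + (y - Im c)\<^sup>2 + z\<^sup>2 = d * z}"

lemma at_boundary_tangent_sphere:
  assumes d: "d > 0"
  shows "at_boundary (tangent_sphere c d) = {Finite c}"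
proof -
  let ?S = "tangent_sphere c d"
  have bd: "bounded ?S"
  proof (rule bounded_subset)
    show "bounded ({Re c - d..Re c + d} \<times> {Im c - d..Im c + d} \<times> {0..d})"
      by (intro bounded_Times bounded_closed_interval)
    show "?S \<subseteq> {Re c - d..Re c + d} \<times> {Im c - d..Im c + d} \<times> {0..d}"
    proof (clarsimp simp: tangent_sphere_def)
      fix x y z assume z: "0 < z" and e: "(x - Re c)\<^sup>2 + (y - Im c)\<^sup>2 + z\<^sup>2 = d * z"
      have "z * z \<le> d * z"
        using e zero_le_power2[of "x - Re c"] zero_le_power2[of "y - Im c"] unfolding power2_eq_square by linarith
      then have zd: "z \<le> d" using z by simp
      then have "d * z \<le> d\<^sup>2" using d by (simp add: power2_eq_square)
      then have "(x - Re c)\<^sup>2 \<le> d\<^sup>2" "(y - Im c)\<^sup>2 \<le> d\<^sup>2"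
        using e zero_le_power2[of "x - Re c"] zero_le_power2[of "y - Im c"] zero_le_power2[of z] by linarith+
      then have "\<bar>x - Re c\<bar> \<le> d" "\<bar>y - Im c\<bar> \<le> d"
        using d by (auto intro: power2_le_imp_le simp: abs_le_square_iff[symmetric])
      then show "Re c - d \<le> x \<and> x \<le> Re c + d \<and> Im c - d \<le> y \<and> y \<le> Im c + d \<and> z \<le> d"
        using zd by (auto simp: abs_le_iff)
    qed
  qed
  have only: "e = c" if "horizontal e \<in> closure ?S" for e
  proof -
    let ?C = "{q :: point3. (fst q - Re c)\<^sup>2 + (fst (snd q) - Im c)\<^sup>2 + (snd (snd q))\<^sup>2 = d * snd (snd q)}"
    have "closed ?C" by (intro closed_Collect_eq continuous_intros)
    moreover have "?S \<subseteq> ?C" by (auto simp: tangent_sphere_def)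
    ultimately have "horizontal e \<in> ?C" using that closure_minimal by blast
    then show ?thesis by (simp add: horizontal_def complex_eq_iff sum_power2_eq_zero_iff)
  qed
  have "horizontal c \<in> closure ?S"
  proof (rule Lim_in_closed_set[OF closed_closure])
    \<comment> \<open>A meridian of the sphere, parametrized by its height, which descends to the point of tangency.\<close>
    let ?f = "\<lambda>t. (Re c + sqrt (d * t - t\<^sup>2), Im c, t)"
    have "(?f \<longlongrightarrow> (Re c + sqrt (d * 0 - 0\<^sup>2), Im c, 0)) (at_right 0)"
      by (intro tendsto_intros)
    then show "(?f \<longlongrightarrow> horizontal c) (at_right 0)" by (simp add: horizontal_def)
    show "eventually (\<lambda>t. ?f t \<in> closure ?S) (at_right 0)"
    proof -
      have "?f t \<in> ?S" if "0 < t" "t < d" for t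
        using that mult_strict_right_mono[of t d t] by (simp add: tangent_sphere_def power2_eq_square)
      then show ?thesis
        using d closure_subset[of ?S] unfolding eventually_at_right_field by blast
    qed
  qed simp
  with only bd show ?thesis
    unfolding at_boundary_def by (auto split: boundary_point.splits)
qed

lemma north_pole_tangent_sphere:
  assumes d: "d > 0"
  shows "north_pole (tangent_sphere c d) (Re c, Im c, d)"
  unfolding north_pole_def
proof (intro conjI ballI impI)
  show "(Re c, Im c, d) \<in> tangent_sphere c d" using d by (simp add: tangent_sphere_def power2_eq_square)
  fix q assume q: "q \<in> tangent_sphere c d" "q \<noteq> (Re c, Im c, d)"
  obtain x y z where xyz: "q = (x, y, z)" by (cases q)
  have z: "z > 0" and e: "(x - Re c)\<^sup>2 + (y - Im c)\<^sup>2 = z * (d - z)"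
    using q by (auto simp: xyz tangent_sphere_def power2_eq_square algebra_simps)
  have "z * (d - z) \<ge> 0" unfolding e[symmetric] by simp
  then have "z \<le> d" using z by (simp add: zero_le_mult_iff)
  moreover have "z \<noteq> d" using e q(2) by (auto simp: xyz sum_power2_eq_zero_iff)
  ultimately show "height q < height (Re c, Im c, d)" by (simp add: xyz height_def)
qed


section \<open>The horosphere of a spinor\<close>

lemma phi1_components:
  fixes \<xi> \<eta> :: complex
  defines "p \<equiv> phi1 (vector [\<xi>, \<eta>])"
  shows "p$1 = (cmod \<xi>)\<^sup>2 + (cmod \<eta>)\<^sup>2" "p$4 = (cmod \<xi>)\<^sup>2 - (cmod \<eta>)\<^sup>2" "Complex (p$2) (p$3) = 2 * \<xi> * cnj \<eta>"
  unfolding cmod_power2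
  by (simp_all add: p_def phi1_def mink_of_herm_def outer_def complex_eq_iff power2_eq_square)

text \<open>The off-diagonal entry \<open>i (\<xi>\<^sup>2 + (cnj \<eta>)\<^sup>2)\<close> of the Hermitian matrix gives the direction
  of the decoration, up to the contribution of a multiple of \<open>p\<close>.\<close>

lemma D_phi1_Z_map_components:
  fixes \<xi> \<eta> :: complex
  defines "v \<equiv> D_phi1 (vector [\<xi>, \<eta>]) (Z_map (vector [\<xi>, \<eta>]))"
  shows "v$1 = 0" "v$4 = 4 * Im (\<xi> * \<eta>)" "Complex (v$2) (v$3) = 2 * \<i> * (\<xi>\<^sup>2 + (cnj \<eta>)\<^sup>2)"
  by (simp_all add: v_def D_phi1_def Z_map_def mink_of_herm_def outer_def complex_eq_iff power2_eq_square algebra_simps)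

text \<open>Equating this to \<open>1\<close> gives the equation of the horosphere in upper half space.\<close>

lemma mink_hyperboloid_of_uhs_phi1:
  assumes "z > 0"
  shows "mink (hyperboloid_of_uhs (x, y, z)) (phi1 (vector [\<xi>, \<eta>])) =
    ((cmod (\<eta> * Complex x y - \<xi>))\<^sup>2 + (cmod \<eta>)\<^sup>2 * z\<^sup>2) / z"
  using assms unfolding cmod_power2
  by (simp add: mink_def hyperboloid_of_uhs_def phi1_def mink_of_herm_def outer_def power2_eq_square field_simps)

text \<open>For \<open>\<eta> = 0\<close> the vector \<open>p\<close> is killed by the derivative, so the direction is that of \<open>v\<close>
  alone and is constant along the plane.\<close>

lemma open_ray_D_uhs_infinity:
  fixes \<xi> :: complex
  defines "p \<equiv> phi1 (vector [\<xi>, 0])" and "v \<equiv> D_phi1 (vector [\<xi>, 0]) (Z_map (vector [\<xi>, 0]))"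
  assumes x: "x \<in> hyperboloid"
  shows "open_ray (D_uhs x (v - r *\<^sub>R p)) = open_ray (horizontal (\<i> * \<xi>\<^sup>2))"
proof -
  let ?u = "v - r *\<^sub>R p"
  note pc = phi1_components[of \<xi> 0, folded p_def] and vc = D_phi1_Z_map_components[of \<xi> 0, folded v_def]
  have "?u$1 = ?u$4" using pc vc by simp
  moreover have "Complex (?u$2) (?u$3) = 2 * (\<i> * \<xi>\<^sup>2)"
    using pc(3) vc(3) by (simp add: complex_eq_iff)
  ultimately have "D_uhs x ?u = (2 / (x$1 - x$4)) *\<^sub>R horizontal (\<i> * \<xi>\<^sup>2)"
    by (simp add: D_uhs_horizontal) (simp add: horizontal_def)
  then show ?thesis using hyperboloid_pos[OF x] by (simp add: open_ray_scaleR)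
qed

text \<open>The north pole of the horosphere lies on the geodesic from \<open>\<xi> / \<eta>\<close> to infinity, hence in
  the span of \<open>p\<close> and of the null vector \<open>l\<close> that represents infinity. This makes \<open>\<langle>v, q\<rangle>\<close> a
  multiple of \<open>\<langle>v, l\<rangle>\<close>.\<close>

lemma open_ray_D_uhs_north_pole:
  fixes \<xi> \<eta> :: complex
  defines "p \<equiv> phi1 (vector [\<xi>, \<eta>])" and "v \<equiv> D_phi1 (vector [\<xi>, \<eta>]) (Z_map (vector [\<xi>, \<eta>]))"
    and "q \<equiv> hyperboloid_of_uhs (Re (\<xi> / \<eta>), Im (\<xi> / \<eta>), 1 / (cmod \<eta>)\<^sup>2)"
  assumes \<eta>: "\<eta> \<noteq> 0"
  shows "open_ray (D_uhs q (v - mink v q *\<^sub>R p)) = open_ray (horizontal (\<i> / \<eta>\<^sup>2))"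
proof -
  define N where "N = (cmod \<eta>)\<^sup>2"
  have N: "N > 0" using \<eta> by (simp add: N_def)
  have Nc: "complex_of_real N = \<eta> * cnj \<eta>" unfolding N_def by (rule complex_norm_square)
  note pc = phi1_components[of \<xi> \<eta>, folded p_def N_def]
    and vc = D_phi1_Z_map_components[of \<xi> \<eta>, folded v_def]
  have vp: "mink v p = 0" unfolding v_def p_def by (rule mink_phi1_D_phi1)
  define l :: "real^4" where "l = vector [1, 0, 0, 1]"
  have q: "q = (1 / 2) *\<^sub>R p + (1 / (2 * N)) *\<^sub>R l"
  proof -
    have "\<xi> / \<eta> = Complex (p$2) (p$3) / of_real (2 * N)"
      unfolding pc using \<eta> by (simp add: Nc)
    then have w: "Re (\<xi> / \<eta>) = p$2 / (2 * N)" "Im (\<xi> / \<eta>) = p$3 / (2 * N)"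
      by (simp_all only: Re_divide_of_real Im_divide_of_real complex.sel)
    have "(Re (\<xi> / \<eta>))\<^sup>2 + (Im (\<xi> / \<eta>))\<^sup>2 = (cmod \<xi>)\<^sup>2 / N"
      unfolding cmod_power2[symmetric] N_def by (simp add: norm_divide power_divide)
    then show ?thesis
      unfolding q_def N_def[symmetric] hyperboloid_of_uhs_def prod.case
      using N w pc(1,2) by (simp add: vec_eq_iff forall_4 l_def) (simp add: field_simps power2_eq_square)
  qed
  have vq: "mink v q = - v$4 / (2 * N)"
    unfolding q mink_simps vp by (simp add: mink_def l_def vc)
  let ?u = "v - mink v q *\<^sub>R p"
  have "?u$1 = ?u$4" using N by (simp add: vq pc vc field_simps)
  moreover have "Complex (?u$2) (?u$3) = of_real (2 * N * ((cmod \<xi>)\<^sup>2 + N)) * (\<i> / \<eta>\<^sup>2)"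
  proof -
    have "Complex (?u$2) (?u$3) = Complex (v$2) (v$3) + of_real (v$4 / (2 * N)) * Complex (p$2) (p$3)"
      by (simp add: vq complex_eq_iff)
    also have "\<dots> = 2 * \<i> * (\<xi>\<^sup>2 + (cnj \<eta>)\<^sup>2) + of_real (4 * Im (\<xi> * \<eta>) / (2 * N)) * (2 * \<xi> * cnj \<eta>)"
      unfolding pc vc by (simp add: mult.assoc)
    also have "\<dots> = of_real (2 * N * ((cmod \<xi>)\<^sup>2 + N)) * (\<i> / \<eta>\<^sup>2)"
    proof -
      have Im: "of_real (Im z) = - (\<i> / 2) * (z - cnj z)" for z
        by (simp add: complex_eq_iff)
      \<comment> \<open>With \<open>a'\<close> and \<open>b'\<close> independent of \<open>a\<close> and \<open>b\<close>, instead of conjugates, this is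
        an identity of rational functions.\<close>
      have "2 * j * (a\<^sup>2 + b'\<^sup>2) + 4 * (- (j / 2) * (a * b - a' * b')) / (2 * (b * b')) * (2 * a * b') =
          2 * (b * b') * (a * a' + b * b') * (j / b\<^sup>2)" if "b \<noteq> 0" "b' \<noteq> 0" for a a' b b' j :: complex
      proof -
        have "4 * (- (j / 2) * (a * b - a' * b')) / (2 * (b * b')) * (2 * a * b') = - 2 * j * (a * b - a' * b') * a / b"
          using that by (simp add: divide_simps)
        then show ?thesis
          using that by (simp add: divide_simps power2_eq_square) (simp add: algebra_simps)
      qed
      from this[of \<eta> "cnj \<eta>" \<i> \<xi> "cnj \<xi>"] \<eta> show ?thesis
        unfolding of_real_mult of_real_divide of_real_add of_real_numeral Im Nc complex_norm_square complex_cnj_mult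
        by simp
    qed
    finally show ?thesis .
  qed
  ultimately have "D_uhs q ?u = (1 / (q$1 - q$4) * (2 * N * ((cmod \<xi>)\<^sup>2 + N))) *\<^sub>R horizontal (\<i> / \<eta>\<^sup>2)"
    by (simp only: D_uhs_horizontal horizontal_of_real_mult scaleR_scaleR)
  moreover have "q$1 - q$4 > 0"
    unfolding q_def using \<eta> by (intro hyperboloid_pos hyperboloid_of_uhs_in) (simp add: height_def)
  moreover have "(cmod \<xi>)\<^sup>2 + N > 0" using N by (simp add: add_nonneg_pos)
  ultimately show ?thesis using N by (simp add: open_ray_scaleR)
qed

theorem proposition3p10:
  fixes \<xi> \<eta> :: complex and G :: "point3 \<Rightarrow> point3"
  assumes "(\<xi>, \<eta>) \<noteq> (0, 0)"
    and "is_ball_to_uhs G"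
  shows "decorated_horosphere (Phi2 (Phi1 (vector [\<xi>, \<eta>]))) \<and>
    (let D = to_uhs G (Phi2 (Phi1 (vector [\<xi>, \<eta>]))) in
      has_centre D (if \<eta> = 0 then Infinity else Finite (\<xi> / \<eta>)) \<and>
      (\<eta> \<noteq> 0 \<longrightarrow> has_euclidean_diameter D (1 / (cmod \<eta>)\<^sup>2) \<and>
                 north_pole_specified_by D (\<i> / \<eta>\<^sup>2)) \<and>
      (\<eta> = 0 \<longrightarrow> has_height D ((cmod \<xi>)\<^sup>2) \<and> specified_by D (\<i> * \<xi>\<^sup>2)))"
proof -
  let ?\<kappa> = "vector [\<xi>, \<eta>] :: complex^2"
  define p v where "p = phi1 ?\<kappa>" and "v = D_phi1 ?\<kappa> (Z_map ?\<kappa>)"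
  have Phi1: "Phi1 ?\<kappa> = flag_of p v" by (simp add: Phi1_def p_def v_def)
  have "?\<kappa> \<noteq> 0" using assms(1) by (auto simp: vec_eq_iff forall_2)
  then have p: "p \<in> light_cone" unfolding p_def by (rule phi1_in_light_cone)
  have vp: "mink v p = 0" and vv: "mink v v < 0"
    using mink_phi1_D_phi1[of ?\<kappa>] p by (auto simp: p_def v_def light_cone_def)
  define D where "D = to_uhs G (Phi2 (Phi1 ?\<kappa>))"
  have S: "fst D = {y. height y > 0 \<and> mink (hyperboloid_of_uhs y) p = 1}"
    unfolding D_def Phi1 by (rule to_uhs_Phi2[OF assms(2) p vp])
  have l: "snd D y = open_ray (D_uhs (hyperboloid_of_uhs y) (v - mink v (hyperboloid_of_uhs y) *\<^sub>R p))"
    if "y \<in> fst D" for y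
    unfolding D_def Phi1 using that by (intro to_uhs_Phi2[OF assms(2) p vp]) (simp_all add: S)
  have "has_centre D (if \<eta> = 0 then Infinity else Finite (\<xi> / \<eta>)) \<and>
      (\<eta> \<noteq> 0 \<longrightarrow> has_euclidean_diameter D (1 / (cmod \<eta>)\<^sup>2) \<and> north_pole_specified_by D (\<i> / \<eta>\<^sup>2)) \<and>
      (\<eta> = 0 \<longrightarrow> has_height D ((cmod \<xi>)\<^sup>2) \<and> specified_by D (\<i> * \<xi>\<^sup>2))"
  proof (cases "\<eta> = 0")
    case True
    then have \<xi>: "\<xi> \<noteq> 0" using assms(1) by simp
    have plane: "fst D = {y. height y = (cmod \<xi>)\<^sup>2}"
    proof -
      have "height y > 0 \<and> mink (hyperboloid_of_uhs y) p = 1 \<longleftrightarrow> height y = (cmod \<xi>)\<^sup>2" for y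
        using \<xi> by (cases y) (auto simp: p_def mink_hyperboloid_of_uhs_phi1 height_def True)
      then show ?thesis by (simp add: S)
    qed
    have "snd D y = open_ray (horizontal (\<i> * \<xi>\<^sup>2))" if "y \<in> fst D" for y
      unfolding l[OF that] p_def v_def True
      using that by (intro open_ray_D_uhs_infinity hyperboloid_of_uhs_in) (simp add: S)
    then have "specified_by D (\<i> * \<xi>\<^sup>2)" using \<xi> by (simp add: specified_by_def)
    then show ?thesis
      using True \<xi> plane at_boundary_plane[of "(cmod \<xi>)\<^sup>2"] by (simp add: has_centre_def has_height_def)
  next
    case False
    define c d where "c = \<xi> / \<eta>" and "d = 1 / (cmod \<eta>)\<^sup>2"
    have d: "d > 0" using False by (simp add: d_def)
    have sphere: "fst D = tangent_sphere c d"
    proof -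
      have "(x, y, z) \<in> fst D \<longleftrightarrow> (x, y, z) \<in> tangent_sphere c d" for x y z
      proof (cases "z > 0")
        case z: True
        have "cmod (\<eta> * Complex x y - \<xi>) = cmod \<eta> * cmod (Complex x y - c)"
          using False by (simp add: c_def norm_mult[symmetric] algebra_simps)
        then have "mink (hyperboloid_of_uhs (x, y, z)) p = ((cmod (Complex x y - c))\<^sup>2 + z\<^sup>2) / (d * z)"
          using z by (simp add: p_def mink_hyperboloid_of_uhs_phi1 d_def power_mult_distrib algebra_simps)
        then show ?thesis using z d by (auto simp: S tangent_sphere_def height_def cmod_power2)
      qed (simp add: S tangent_sphere_def height_def)
      then show ?thesis by auto
    qed
    let ?n = "(Re c, Im c, d)"
    have n: "north_pole (fst D) ?n"
      unfolding sphere by (rule north_pole_tangent_sphere[OF d])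
    then have "?n \<in> fst D" by (simp add: north_pole_def)
    then have "snd D ?n = open_ray (horizontal (\<i> / \<eta>\<^sup>2))"
      unfolding p_def v_def c_def d_def by (simp only: l[unfolded p_def v_def] open_ray_D_uhs_north_pole[OF False])
    with n have "north_pole_specified_by D (\<i> / \<eta>\<^sup>2)"
      using False by (auto simp: north_pole_specified_by_def)
    moreover have "has_euclidean_diameter D d"
      using n by (auto simp: has_euclidean_diameter_def height_def)
    moreover have "has_centre D (Finite c)"
      using at_boundary_tangent_sphere[OF d] by (simp add: has_centre_def sphere)
    ultimately show ?thesis using False by (simp add: c_def d_def)
  qed
  then show ?thesis
    using decorated_horosphere_Phi2[OF p vp vv] unfolding D_def Let_def Phi1 by blast
qed

end
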